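(* Let $n\in\mathbb{N}$ and let $G$ be a finitely generated amenable group. Let $H\leq G$ be a subgroup such that $[G:H]=\infty$ and such that the map $H_n(i)\colon H_n(H;\mathbb{R})\to H_n(G;\mathbb{R})$ in group homology induced by the inclusion $i\colon H\hookrightarrow G$ is non-trivial (i.e. not the zero map). Then $\dim_{\mathbb{R}} H_n^{\mathrm{uf}}(G;\mathbb{R})=\infty$.
   Context: Groups are discrete and $\mathbb{N}$ contains $0$. $H_n(-;\mathbb{R})$ is ordinary group homology with trivial real coefficients. $\ell^\infty(G)$ is the space of bounded functions $G\to\mathbb{R}$ with left action $(g\cdot\varphi)(g')=\varphi(g^{-1}g')$. A group $G$ is amenable if there is a left $G$-invariant mean on $\ell^\infty(G)$, i.e. a linear map $m\colon\ell^\infty(G)\to\mathbb{R}$ with $m(\chi_G)=1$, with $m(\varphi)\ge 0$ whenever $\varphi\geq 0$, and with $m(g\cdot\varphi)=m(\varphi)$ for all $g\in G$, $\varphi\in\ell^\infty(G)$. Uniformly finite homology. Let $(X,d)$ be a metric space. $C_n^{\mathrm{uf}}(X;\mathbb{R})$ is the real vector space of functions $c\colon X^{n+1}\to\mathbb{R}$ such that (a) $c$ is bounded; (b) for all $r>0$ there is $K_r>0$ such that for all $y\in X^{n+1}$ one has $|\{x\in B_r(y): c(x)\neq 0\}|\le K_r$, where $X^{n+1}$ carries the maximum metric; (c) there is $R_c>0$ such that $c(x)=0$ whenever $\sup_{i,j} d(x_i,x_j)>R_c$. Writing $c$ as a formal sum $\sum_x c(x)\cdot x$, the boundary operator $\partial_n\colon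 C_n^{\mathrm{uf}}\to C_{n-1}^{\mathrm{uf}}$ is given by $\partial_n(x_0,\dots,x_n)=\sum_{j=0}^n(-1)^j(x_0,\dots,\widehat{x_j},\dots,x_n)$, extended to (infinite) formal sums. $H_*^{\mathrm{uf}}(X;\mathbb{R})$ is the homology of this complex. For a finitely generated group $G$, $H_*^{\mathrm{uf}}(G;\mathbb{R})$ is defined using the word metric $d_S(g,h)=\min\{k: g^{-1}h=s_1\cdots s_k,\ s_i\in S\cup S^{-1}\}$ for a finite generating set $S$; up to canonical isomorphism it does not depend on $S$ (and condition (b) is automatic in this case). *)

theory Defs
  imports "Jordan_Normal_Form.VS_Connect" "HOL-Algebra.AbelCoset" "HOL-Algebra.Generated_Groups"
begin

section \<open>Homology of complexes of real-valued functions\<close>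

text \<open>
  Every chain module below is a set of functions \<^typ>\<open>'x \<Rightarrow> real\<close>, a function \<open>c\<close> standing for the
  formal sum of the \<open>c x \<cdot> x\<close>, and is closed under the pointwise vector space operations. The
  fields \<open>mult\<close> and \<open>one\<close> of a HOL-Algebra module record carry no meaning for a module.
\<close>

definition fun_space :: "('x \<Rightarrow> real) set \<Rightarrow> (real, 'x \<Rightarrow> real) module" where
  "fun_space V =
    \<lparr>carrier = V, mult = undefined, one = undefined,
     zero = (\<lambda>x. 0), add = (\<lambda>f g x. f x + g x), smult = (\<lambda>r f x. r * f x)\<rparr>"

definition quotient_space :: "('r, 'm) module \<Rightarrow> 'm set \<Rightarrow> ('r, 'm set) module" where
  "quotient_space V W =
    \<lparr>carrier = a_rcosets\<^bsub>V\<^esub> W, mult = undefined, one = undefined,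
     zero = W, add = (\<lambda>A B. A <+>\<^bsub>V\<^esub> B), smult = (\<lambda>r A. \<Union>v\<in>A. W +>\<^bsub>V\<^esub> (r \<odot>\<^bsub>V\<^esub> v))\<rparr>"

text \<open>\<open>C n\<close> is the space of \<open>n\<close>-chains and \<open>d n\<close> the boundary operator from \<open>C n\<close> to \<open>C (n - 1)\<close>.\<close>

definition cycle_space ::
    "(nat \<Rightarrow> ('x \<Rightarrow> real) set) \<Rightarrow> (nat \<Rightarrow> ('x \<Rightarrow> real) \<Rightarrow> 'x \<Rightarrow> real) \<Rightarrow> nat \<Rightarrow> ('x \<Rightarrow> real) set" where
  "cycle_space C d n = {c \<in> C n. d n c = (\<lambda>x. 0)}"

definition boundary_space ::
    "(nat \<Rightarrow> ('x \<Rightarrow> real) set) \<Rightarrow> (nat \<Rightarrow> ('x \<Rightarrow> real) \<Rightarrow> 'x \<Rightarrow> real) \<Rightarrow> nat \<Rightarrow> ('x \<Rightarrow> real) set" where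
  "boundary_space C d n = d (Suc n) ` C (Suc n)"

definition homology ::
    "(nat \<Rightarrow> ('x \<Rightarrow> real) set) \<Rightarrow> (nat \<Rightarrow> ('x \<Rightarrow> real) \<Rightarrow> 'x \<Rightarrow> real) \<Rightarrow> nat
      \<Rightarrow> (real, ('x \<Rightarrow> real) set) module" where
  "homology C d n = quotient_space (fun_space (cycle_space C d n)) (boundary_space C d n)"

text \<open>The map induced on homology classes by a chain map \<open>f\<close> into the complex \<open>(C, d)\<close>.\<close>

definition homology_map ::
    "(nat \<Rightarrow> ('x \<Rightarrow> real) set) \<Rightarrow> (nat \<Rightarrow> ('x \<Rightarrow> real) \<Rightarrow> 'x \<Rightarrow> real) \<Rightarrow> nat
      \<Rightarrow> (('y \<Rightarrow> real) \<Rightarrow> 'x \<Rightarrow> real) \<Rightarrow> ('y \<Rightarrow> real) set \<Rightarrow> ('x \<Rightarrow> real) set" where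
  "homology_map C d n f A =
    (\<Union>c\<in>A. boundary_space C d n +>\<^bsub>fun_space (cycle_space C d n)\<^esub> f c)"

definition tuples :: "'a set \<Rightarrow> nat \<Rightarrow> 'a list set" where
  "tuples A k = {xs. set xs \<subseteq> A \<and> length xs = k}"

text \<open>
  The extension of \<open>x \<mapsto> \<Sum>j\<le>n. (-1)^j \<cdot> face j x\<close> to formal sums, written as a formula for the
  coefficient at \<open>y\<close>. The sum over \<open>x\<close> has finitely many terms whenever \<open>c\<close> is a chain in one of the
  two complexes below and \<open>n > 0\<close>; in degree \<open>0\<close> the boundary is zero.
\<close>

definition boundary_op ::
    "(nat \<Rightarrow> 'a list \<Rightarrow> 'a list) \<Rightarrow> nat \<Rightarrow> ('a list \<Rightarrow> real) \<Rightarrow> 'a list \<Rightarrow> real" where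
  "boundary_op face n c =
    (if n = 0 then (\<lambda>y. 0)
     else (\<lambda>y. \<Sum>j\<le>n. (-1) ^ j * (\<Sum>x | c x \<noteq> 0 \<and> face j x = y. c x)))"


section \<open>Group homology with trivial real coefficients\<close>

text \<open>
  Computed by the (inhomogeneous) bar complex: \<open>n\<close>-chains are the finitely supported functions on
  \<open>n\<close>-tuples \<open>[g\<^sub>1|\<dots>|g\<^sub>n]\<close> of group elements.
\<close>

definition bar_face :: "('a, 'b) monoid_scheme \<Rightarrow> nat \<Rightarrow> 'a list \<Rightarrow> 'a list" where
  "bar_face G j xs =
    (if j = 0 then tl xs
     else if j = length xs then butlast xs
     else take (j - 1) xs @ [xs ! (j - 1) \<otimes>\<^bsub>G\<^esub> xs ! j] @ drop (j + 1) xs)"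

definition bar_chains :: "('a, 'b) monoid_scheme \<Rightarrow> nat \<Rightarrow> ('a list \<Rightarrow> real) set" where
  "bar_chains G n = {c. finite {x. c x \<noteq> 0} \<and> (\<forall>x. x \<notin> tuples (carrier G) n \<longrightarrow> c x = 0)}"

definition group_homology ::
    "('a, 'b) monoid_scheme \<Rightarrow> nat \<Rightarrow> (real, ('a list \<Rightarrow> real) set) module" where
  "group_homology G n = homology (bar_chains G) (boundary_op (bar_face G)) n"

definition bar_map :: "('a \<Rightarrow> 'b) \<Rightarrow> ('a list \<Rightarrow> real) \<Rightarrow> 'b list \<Rightarrow> real" where
  "bar_map f c y = (\<Sum>x | c x \<noteq> 0 \<and> map f x = y. c x)"

text \<open>The map \<open>H\<^sub>n(f)\<close> for a group homomorphism \<open>f\<close> with codomain \<open>G\<close>.\<close>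

definition group_homology_map ::
    "('b, 'c) monoid_scheme \<Rightarrow> nat \<Rightarrow> ('a \<Rightarrow> 'b) \<Rightarrow> ('a list \<Rightarrow> real) set \<Rightarrow> ('b list \<Rightarrow> real) set" where
  "group_homology_map G n f = homology_map (bar_chains G) (boundary_op (bar_face G)) n (bar_map f)"


section \<open>Amenability\<close>

text \<open>Functions on \<^term>\<open>carrier G\<close> are represented by their extension by zero.\<close>

definition linfty :: "('a, 'b) monoid_scheme \<Rightarrow> ('a \<Rightarrow> real) set" where
  "linfty G = {\<phi>. (\<forall>x. x \<notin> carrier G \<longrightarrow> \<phi> x = 0) \<and> (\<exists>B. \<forall>x\<in>carrier G. \<bar>\<phi> x\<bar> \<le> B)}"

definition left_translate :: "('a, 'b) monoid_scheme \<Rightarrow> 'a \<Rightarrow> ('a \<Rightarrow> real) \<Rightarrow> 'a \<Rightarrow> real" where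
  "left_translate G g \<phi> = (\<lambda>x. if x \<in> carrier G then \<phi> (inv\<^bsub>G\<^esub> g \<otimes>\<^bsub>G\<^esub> x) else 0)"

definition left_invariant_mean :: "('a, 'b) monoid_scheme \<Rightarrow> (('a \<Rightarrow> real) \<Rightarrow> real) \<Rightarrow> bool" where
  "left_invariant_mean G m \<longleftrightarrow>
    (\<forall>\<phi>\<in>linfty G. \<forall>\<psi>\<in>linfty G. m (\<lambda>x. \<phi> x + \<psi> x) = m \<phi> + m \<psi>) \<and>
    (\<forall>\<phi>\<in>linfty G. \<forall>r. m (\<lambda>x. r * \<phi> x) = r * m \<phi>) \<and>
    m (\<lambda>x. if x \<in> carrier G then 1 else 0) = 1 \<and>
    (\<forall>\<phi>\<in>linfty G. (\<forall>x\<in>carrier G. \<phi> x \<ge> 0) \<longrightarrow> m \<phi> \<ge> 0) \<and>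
    (\<forall>g\<in>carrier G. \<forall>\<phi>\<in>linfty G. m (left_translate G g \<phi>) = m \<phi>)"

definition amenable :: "('a, 'b) monoid_scheme \<Rightarrow> bool" where
  "amenable G \<longleftrightarrow> (\<exists>m. left_invariant_mean G m)"


section \<open>Uniformly finite homology\<close>

text \<open>\<open>(n + 1)\<close>-tuples are lists of length \<open>n + 1\<close>; chains vanish on all other lists.\<close>

definition max_dist :: "('a \<Rightarrow> 'a \<Rightarrow> real) \<Rightarrow> 'a list \<Rightarrow> 'a list \<Rightarrow> real" where
  "max_dist d x y = Max ((\<lambda>i. d (x ! i) (y ! i)) ` {..<length x})"

definition tuple_diam :: "('a \<Rightarrow> 'a \<Rightarrow> real) \<Rightarrow> 'a list \<Rightarrow> real" where
  "tuple_diam d x = Max ((\<lambda>(i, j). d (x ! i) (x ! j)) ` ({..<length x} \<times> {..<length x}))"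

definition uf_chains :: "'a set \<Rightarrow> ('a \<Rightarrow> 'a \<Rightarrow> real) \<Rightarrow> nat \<Rightarrow> ('a list \<Rightarrow> real) set" where
  "uf_chains X d n =
    {c. (\<forall>x. x \<notin> tuples X (n + 1) \<longrightarrow> c x = 0) \<and>
        (\<exists>B. \<forall>x\<in>tuples X (n + 1). \<bar>c x\<bar> \<le> B) \<and>
        (\<forall>r>0. \<exists>K>0. \<forall>y\<in>tuples X (n + 1).
           finite {x \<in> tuples X (n + 1). max_dist d x y < r \<and> c x \<noteq> 0} \<and>
           card {x \<in> tuples X (n + 1). max_dist d x y < r \<and> c x \<noteq> 0} \<le> K) \<and>
        (\<exists>R>0. \<forall>x\<in>tuples X (n + 1). tuple_diam d x > R \<longrightarrow> c x = 0)}"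

definition delete_face :: "nat \<Rightarrow> 'a list \<Rightarrow> 'a list" where
  "delete_face j xs = take j xs @ drop (Suc j) xs"

definition uf_homology ::
    "'a set \<Rightarrow> ('a \<Rightarrow> 'a \<Rightarrow> real) \<Rightarrow> nat \<Rightarrow> (real, ('a list \<Rightarrow> real) set) module" where
  "uf_homology X d n = homology (uf_chains X d) (boundary_op delete_face) n"

definition word_metric :: "('a, 'b) monoid_scheme \<Rightarrow> 'a set \<Rightarrow> 'a \<Rightarrow> 'a \<Rightarrow> real" where
  "word_metric G S g h =
    real (LEAST k. \<exists>ss. length ss = k \<and> set ss \<subseteq> S \<union> m_inv G ` S \<and>
                        foldr (\<otimes>\<^bsub>G\<^esub>) ss \<one>\<^bsub>G\<^esub> = inv\<^bsub>G\<^esub> g \<otimes>\<^bsub>G\<^esub> h)"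

end

theory Submission
  imports Defs "HOL-Library.Indicator_Function" "HOL-Library.Countable_Set"
begin

text \<open>
  Writing a tuple as \<open>(x, x g\<^sub>1, x g\<^sub>1 g\<^sub>2, \<dots>)\<close> identifies a uniformly finite chain with a family of
  bounded functions of \<open>x\<close>, indexed by finitely many bar tuples \<open>[g\<^sub>1|\<dots>|g\<^sub>n]\<close>. Applying a
  right-invariant functional \<open>m\<close> to these functions is a chain map to the bar complex of \<open>G\<close>.
  Conversely, a bar cycle \<open>z\<close> of \<open>H\<close> and a bounded function \<open>\<phi>\<close> on \<open>G\<close> that is right \<open>H\<close>-invariant give
  the uniformly finite cycle \<open>\<phi> \<cdot> z\<close>, which \<open>m\<close> sends to \<open>m(\<phi>) z\<close>. If \<open>z\<close> is not a boundary in \<open>G\<close>,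
  it suffices to find sequences with \<open>m\<^sub>i(\<phi>\<^sub>j) = \<delta>\<^sub>i\<^sub>j\<close>.

  Let \<open>F\<^sub>1 \<subseteq> F\<^sub>2 \<subseteq> \<dots>\<close> be finite sets exhausting \<open>G\<close>. As \<open>H\<close> has infinite index, there are \<open>x\<^sub>n\<close> for
  which the blocks \<open>x\<^sub>n F\<^sub>n H\<close> are pairwise disjoint. Split the blocks into infinitely many infinite
  families; \<open>\<phi>\<^sub>j\<close> is the indicator function of the union of the \<open>j\<close>-th family, and \<open>m\<^sub>j\<close> averages
  \<open>g \<mapsto> lim f(x\<^sub>n g)\<close>, with \<open>n\<close> running through the \<open>j\<close>-th family, by an invariant mean. The mean
  itself also serves as the generalised limit.
\<close>

section \<open>Linear algebra of function spaces\<close>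

definition function_subspace :: "('x \<Rightarrow> real) set \<Rightarrow> bool" where
  "function_subspace V \<longleftrightarrow> (\<lambda>x. 0) \<in> V \<and>
     (\<forall>f\<in>V. \<forall>g\<in>V. (\<lambda>x. f x + g x) \<in> V) \<and> (\<forall>r. \<forall>f\<in>V. (\<lambda>x. r * f x) \<in> V)"

lemma function_subspaceI:
  assumes "(\<lambda>x. 0) \<in> V"
    and "\<And>f g. f \<in> V \<Longrightarrow> g \<in> V \<Longrightarrow> (\<lambda>x. f x + g x) \<in> V"
    and "\<And>r f. f \<in> V \<Longrightarrow> (\<lambda>x. r * f x) \<in> V"
  shows "function_subspace V"
  using assms by (simp add: function_subspace_def)

lemma function_subspace_zero: "function_subspace V \<Longrightarrow> (\<lambda>x. 0) \<in> V"
  and function_subspace_add: "function_subspace V \<Longrightarrow> f \<in> V \<Longrightarrow> g \<in> V \<Longrightarrow> (\<lambda>x. f x + g x) \<in> V"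
  and function_subspace_scale: "function_subspace V \<Longrightarrow> f \<in> V \<Longrightarrow> (\<lambda>x. r * f x) \<in> V"
  by (simp_all add: function_subspace_def)

lemma function_subspace_diff:
  assumes "function_subspace V" "f \<in> V" "g \<in> V"
  shows "(\<lambda>x. f x - g x) \<in> V"
  using function_subspace_add[OF assms(1,2) function_subspace_scale[OF assms(1,3), of "-1"]]
  by simp

text \<open>A record-free form of the cosets in \<open>fun_space V\<close>. It depends on
  \<open>W\<close> and \<open>v\<close> alone, so cosets arising in different function spaces can be
  compared directly.\<close>

definition coset :: "('x \<Rightarrow> real) set \<Rightarrow> ('x \<Rightarrow> real) \<Rightarrow> ('x \<Rightarrow> real) set" where
  "coset W v = (\<lambda>w x. w x + v x) ` W"

lemma coset_fun_space: "W +>\<^bsub>fun_space V\<^esub> v = coset W v"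
  by (auto simp: a_r_coset_def' fun_space_def coset_def)

lemma coset_zero: "coset W (\<lambda>x. 0) = W"
  by (simp add: coset_def)

lemma mem_coset_iff: "u \<in> coset W v \<longleftrightarrow> (\<lambda>x. u x - v x) \<in> W"
proof
  assume "(\<lambda>x. u x - v x) \<in> W"
  then have "(\<lambda>x. (u x - v x) + v x) \<in> coset W v"
    unfolding coset_def by (rule imageI)
  then show "u \<in> coset W v" by simp
qed (auto simp: coset_def)

lemma coset_eq_iff:
  assumes W: "function_subspace W"
  shows "coset W v = coset W w \<longleftrightarrow> (\<lambda>x. v x - w x) \<in> W"
proof
  assume "coset W v = coset W w"
  moreover have "v \<in> coset W v"
    by (simp add: mem_coset_iff function_subspace_zero[OF W])
  ultimately show "(\<lambda>x. v x - w x) \<in> W" by (simp add: mem_coset_iff)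
next
  assume a: "(\<lambda>x. v x - w x) \<in> W"
  show "coset W v = coset W w"
  proof (rule Set.set_eqI)
    fix u
    show "u \<in> coset W v \<longleftrightarrow> u \<in> coset W w"
      using function_subspace_add[OF W _ a, of "\<lambda>x. u x - v x"]
        function_subspace_diff[OF W _ a, of "\<lambda>x. u x - w x"]
      by (auto simp: mem_coset_iff)
  qed
qed

section \<open>Quotients of function spaces\<close>

context
  fixes V W :: "('x \<Rightarrow> real) set" and Q
  assumes V: "function_subspace V" and W: "function_subspace W" and WV: "W \<subseteq> V"
  defines "Q \<equiv> quotient_space (fun_space V) W"
begin

lemma quotient_carrier: "carrier Q = coset W ` V"
  by (auto simp: Q_def quotient_space_def A_RCOSETS_def' coset_fun_space) (auto simp: fun_space_def)

lemma quotient_zero: "\<zero>\<^bsub>Q\<^esub> = coset W (\<lambda>x. 0)"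
  by (simp add: Q_def quotient_space_def coset_zero)

lemma quotient_add: "coset W v \<oplus>\<^bsub>Q\<^esub> coset W w = coset W (\<lambda>x. v x + w x)"
proof -
  have "coset W v \<oplus>\<^bsub>Q\<^esub> coset W w = (\<Union>f\<in>coset W v. \<Union>g\<in>coset W w. {\<lambda>x. f x + g x})"
    by (simp add: Q_def quotient_space_def set_add_def') (simp add: fun_space_def)
  also have "\<dots> = coset W (\<lambda>x. v x + w x)"
  proof (intro equalityI subsetI)
    fix u assume "u \<in> (\<Union>f\<in>coset W v. \<Union>g\<in>coset W w. {\<lambda>x. f x + g x})"
    then obtain f g where fg: "f \<in> coset W v" "g \<in> coset W w" and u: "u = (\<lambda>x. f x + g x)"
      by auto
    have "(\<lambda>x. (f x - v x) + (g x - w x)) \<in> W"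
      using fg by (intro function_subspace_add[OF W]) (simp_all add: mem_coset_iff)
    then show "u \<in> coset W (\<lambda>x. v x + w x)" by (simp add: mem_coset_iff u algebra_simps)
  next
    fix u assume "u \<in> coset W (\<lambda>x. v x + w x)"
    then have "(\<lambda>x. u x - w x) \<in> coset W v" by (simp add: mem_coset_iff algebra_simps)
    moreover have "w \<in> coset W w" by (simp add: mem_coset_iff function_subspace_zero[OF W])
    moreover have "u = (\<lambda>x. (u x - w x) + w x)" by simp
    ultimately show "u \<in> (\<Union>f\<in>coset W v. \<Union>g\<in>coset W w. {\<lambda>x. f x + g x})" by blast
  qed
  finally show ?thesis .
qed

text \<open>Representatives differ by elements of \<open>W\<close>, which is closed under scaling,
  so all members of the union in \<open>quotient_space\<close> are the same coset. For
  \<open>r = 0\<close> the mere image of a coset under scaling would be the zero function alone; the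
  union gives \<open>W\<close>.\<close>

lemma quotient_smult: "r \<odot>\<^bsub>Q\<^esub> coset W v = coset W (\<lambda>x. r * v x)"
proof -
  have "r \<odot>\<^bsub>Q\<^esub> coset W v = (\<Union>u\<in>coset W v. coset W (\<lambda>x. r * u x))"
    by (simp add: Q_def quotient_space_def coset_fun_space) (simp add: fun_space_def)
  also have "\<dots> = (\<Union>u\<in>coset W v. coset W (\<lambda>x. r * v x))"
  proof (intro SUP_cong refl)
    fix u assume "u \<in> coset W v"
    then have "(\<lambda>x. u x - v x) \<in> W" by (simp add: mem_coset_iff)
    then have "(\<lambda>x. r * (u x - v x)) \<in> W" by (rule function_subspace_scale[OF W])
    then show "coset W (\<lambda>x. r * u x) = coset W (\<lambda>x. r * v x)"
      by (simp add: coset_eq_iff[OF W] right_diff_distrib)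
  qed
  also have "\<dots> = coset W (\<lambda>x. r * v x)"
    using function_subspace_zero[OF W] by (auto simp: coset_def)
  finally show ?thesis .
qed

lemma quotient_vectorspace: "vectorspace class_ring Q"
proof -
  note V' = function_subspace_zero[OF V] function_subspace_add[OF V] function_subspace_scale[OF V]
  have "abelian_group Q"
  proof (rule abelian_groupI)
    fix a assume "a \<in> carrier Q"
    then obtain v where v: "v \<in> V" "a = coset W v" by (auto simp: quotient_carrier)
    have "coset W (\<lambda>x. - v x) \<in> carrier Q"
      using V'(3)[OF v(1), of "-1"] by (simp add: quotient_carrier)
    then show "\<exists>b\<in>carrier Q. b \<oplus>\<^bsub>Q\<^esub> a = \<zero>\<^bsub>Q\<^esub>"
      by (rule bexI[rotated]) (simp add: v quotient_add quotient_zero)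
  qed (auto simp: quotient_carrier quotient_zero quotient_add V' add.commute add.left_commute)
  then interpret abelian_group Q .
  have "Module.module class_ring Q"
    by (intro Module.module.intro Module.module_axioms.intro class_cring.is_cring abelian_group_axioms)
      (auto simp: quotient_carrier quotient_smult quotient_add V' algebra_simps)
  then show ?thesis
    by (intro vectorspace.intro class_field)
qed

lemma quotient_finsum:
  assumes "finite J" "\<And>j. j \<in> J \<Longrightarrow> v j \<in> V"
  shows "finsum Q (\<lambda>j. a j \<odot>\<^bsub>Q\<^esub> coset W (v j)) J = coset W (\<lambda>x. \<Sum>j\<in>J. a j * v j x)"
  using assms
proof (induction J)
  case empty
  interpret vectorspace class_ring Q by (rule quotient_vectorspace)
  show ?case by (simp add: quotient_zero)
next
  case (insert j J)
  interpret vectorspace class_ring Q by (rule quotient_vectorspace)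
  have "a i \<odot>\<^bsub>Q\<^esub> coset W (v i) \<in> carrier Q" if "i \<in> insert j J" for i
    using insert.prems[OF that] by (auto simp: quotient_smult quotient_carrier function_subspace_scale[OF V])
  then have "finsum Q (\<lambda>j. a j \<odot>\<^bsub>Q\<^esub> coset W (v j)) (insert j J)
      = a j \<odot>\<^bsub>Q\<^esub> coset W (v j) \<oplus>\<^bsub>Q\<^esub> finsum Q (\<lambda>j. a j \<odot>\<^bsub>Q\<^esub> coset W (v j)) J"
    using insert.hyps by (intro finsum_insert) auto
  also have "\<dots> = coset W (\<lambda>x. a j * v j x + (\<Sum>j\<in>J. a j * v j x))"
    using insert by (simp add: quotient_smult quotient_add)
  finally show ?case using insert.hyps by simp
qed

text \<open>An infinite linearly independent set rules out finite dimension. Independence is asked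
  of representatives modulo \<open>W\<close>, so that applications need not mention cosets.\<close>

lemma quotient_not_fin_dim:
  fixes v :: "nat \<Rightarrow> 'x \<Rightarrow> real"
  assumes v: "\<And>j. v j \<in> V"
    and indep: "\<And>J a i. finite J \<Longrightarrow> i \<in> J \<Longrightarrow> (\<lambda>x. \<Sum>j\<in>J. a j * v j x) \<in> W \<Longrightarrow> a i = 0"
  shows "\<not> vectorspace.fin_dim class_ring Q"
proof
  interpret vectorspace class_ring Q by (rule quotient_vectorspace)
  define q where "q j = coset W (v j)" for j
  \<comment> \<open>Linear independence is a property of sets here. Injectivity makes
    \<open>range q\<close> infinite and lets sums over cosets be reindexed by natural
    numbers.\<close>
  have inj: "inj q"
  proof (rule injI, rule ccontr)
    fix i j assume ij: "q i = q j" "i \<noteq> j"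
    then have "(\<lambda>x. \<Sum>k\<in>{i, j}. (if k = i then 1 else -1) * v k x) \<in> W"
      using ij by (simp add: q_def coset_eq_iff[OF W])
    then show False using indep[of "{i, j}" i "\<lambda>k. if k = i then 1 else -1"] by simp
  qed
  have sub: "range q \<subseteq> carrier Q" using v by (auto simp: q_def quotient_carrier)
  have "lin_indpt (range q)"
  proof (rule ccontr)
    assume "\<not> lin_indpt (range q)"
    then obtain A a u where A: "finite A" "A \<subseteq> range q" "lincomb a A = \<zero>\<^bsub>Q\<^esub>" "u \<in> A" "a u \<noteq> 0"
      by (auto simp: lin_dep_def)
    from A(1,2) inj obtain J where J: "finite J" "A = q ` J"
      by (meson finite_subset_image)
    have inJ: "inj_on q J" using inj by (rule inj_on_subset) simp
    have cl: "a (q j) \<odot>\<^bsub>Q\<^esub> q j \<in> carrier Q" for j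
      using sub by (auto simp: q_def quotient_smult quotient_carrier function_subspace_scale[OF V v])
    have "\<zero>\<^bsub>Q\<^esub> = finsum Q (\<lambda>u. a u \<odot>\<^bsub>Q\<^esub> u) (q ` J)" using A(3) by (simp add: lincomb_def J)
    also have "\<dots> = finsum Q (\<lambda>j. a (q j) \<odot>\<^bsub>Q\<^esub> q j) J"
      using cl by (intro finsum_reindex inJ) auto
    also have "\<dots> = coset W (\<lambda>x. \<Sum>j\<in>J. a (q j) * v j x)"
      unfolding q_def by (intro quotient_finsum J v)
    finally have "(\<lambda>x. \<Sum>j\<in>J. a (q j) * v j x) \<in> W"
      using coset_eq_iff[OF W, of "\<lambda>x. \<Sum>j\<in>J. a (q j) * v j x" "\<lambda>x. 0"]
      by (simp add: quotient_zero)
    moreover obtain i where "i \<in> J" "u = q i" using A(4) J(2) by blast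
    ultimately show False using indep[OF J(1), of i "\<lambda>j. a (q j)"] A(5) by simp
  qed
  moreover assume "fin_dim"
  ultimately have "finite (range q)" using fin_dim_li_fin sub by blast
  then show False using inj by (simp add: finite_image_iff)
qed

end

section \<open>Boundary operators\<close>

lemma boundary_op_scale:
  "boundary_op face n (\<lambda>x. r * c x) = (\<lambda>y. r * boundary_op face n c y)"
\<comment> \<open>The index sets in \<open>boundary_op\<close> are cut out by nonvanishing of
  coefficients: scaling by a nonzero \<open>r\<close> preserves them, scaling by 0 makes them
  empty.\<close>
proof (cases "r = 0")
  case False
  then show ?thesis
    by (auto simp: boundary_op_def fun_eq_iff sum_distrib_left mult.left_commute)
qed (simp add: boundary_op_def fun_eq_iff)

text \<open>The supports of \<open>c\<close>, \<open>e\<close> and their sum differ, so all sums are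
  taken over the union of the first two. Finiteness matters because a sum over an infinite set is 0
  by convention. In degree 0 fibres can be infinite, but the boundary is zero by definition.\<close>

lemma boundary_op_add:
  assumes "\<And>j y. j \<le> n \<Longrightarrow> n > 0 \<Longrightarrow> finite {x. c x \<noteq> 0 \<and> face j x = y}"
    and "\<And>j y. j \<le> n \<Longrightarrow> n > 0 \<Longrightarrow> finite {x. e x \<noteq> 0 \<and> face j x = y}"
  shows "boundary_op face n (\<lambda>x. c x + e x) = (\<lambda>y. boundary_op face n c y + boundary_op face n e y)"
proof (cases "n = 0")
  case False
  have "(\<Sum>x | c x + e x \<noteq> 0 \<and> face j x = y. c x + e x)
      = (\<Sum>x | c x \<noteq> 0 \<and> face j x = y. c x) + (\<Sum>x | e x \<noteq> 0 \<and> face j x = y. e x)"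
    if "j \<le> n" for j y
  proof -
    let ?C = "{x. c x \<noteq> 0 \<and> face j x = y}" and ?E = "{x. e x \<noteq> 0 \<and> face j x = y}"
    have fin: "finite (?C \<union> ?E)" using assms that False by blast
    have "(\<Sum>x | c x + e x \<noteq> 0 \<and> face j x = y. c x + e x) = (\<Sum>x\<in>?C \<union> ?E. c x + e x)"
      by (intro sum.mono_neutral_left fin) auto
    also have "\<dots> = (\<Sum>x\<in>?C \<union> ?E. c x) + (\<Sum>x\<in>?C \<union> ?E. e x)" by (rule sum.distrib)
    also have "(\<Sum>x\<in>?C \<union> ?E. c x) = sum c ?C" by (intro sum.mono_neutral_right fin) auto
    also have "(\<Sum>x\<in>?C \<union> ?E. e x) = sum e ?E" by (intro sum.mono_neutral_right fin) auto
    finally show ?thesis .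
  qed
  then show ?thesis using False
    by (simp add: boundary_op_def fun_eq_iff distrib_left sum.distrib)
qed (simp add: boundary_op_def)

text \<open>Replaces the support-dependent index sets by one finite set \<open>K\<close> of
  parameters for the preimages of \<open>y\<close> under every face. Parameters at which
  \<open>c\<close> vanishes contribute nothing, so \<open>K\<close> may be chosen
  generously.\<close>

lemma boundary_op_eq_sum:
  assumes "n > 0" "finite K"
    and "\<And>j. j \<le> n \<Longrightarrow> inj_on (f j) K"
    and "\<And>j k. j \<le> n \<Longrightarrow> k \<in> K \<Longrightarrow> face j (f j k) = y"
    and "\<And>j x. j \<le> n \<Longrightarrow> c x \<noteq> 0 \<Longrightarrow> face j x = y \<Longrightarrow> x \<in> f j ` K"
  shows "boundary_op face n c y = (\<Sum>j\<le>n. (-1) ^ j * (\<Sum>k\<in>K. c (f j k)))"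
proof -
  have "(\<Sum>x | c x \<noteq> 0 \<and> face j x = y. c x) = (\<Sum>k\<in>K. c (f j k))" if "j \<le> n" for j
  proof -
    have "(\<Sum>x | c x \<noteq> 0 \<and> face j x = y. c x) = sum c (f j ` K)"
      using assms that by (intro sum.mono_neutral_left) auto
    also have "\<dots> = (\<Sum>k\<in>K. c (f j k))" using assms(3)[OF that] by (simp add: sum.reindex)
    finally show ?thesis .
  qed
  then show ?thesis using assms(1) by (simp add: boundary_op_def)
qed

lemma boundary_op_nonzeroE:
  assumes "boundary_op face n c y \<noteq> 0"
  obtains j x where "n > 0" "j \<le> n" "c x \<noteq> 0" "face j x = y"
proof -
  have n: "n \<noteq> 0"
  proof
    assume "n = 0"
    then show False using assms by (simp add: boundary_op_def)
  qed
  then have "(\<Sum>j\<le>n. (-1) ^ j * (\<Sum>x | c x \<noteq> 0 \<and> face j x = y. c x)) \<noteq> 0"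
    using assms by (simp add: boundary_op_def)
  then obtain j where j: "j \<le> n" "(\<Sum>x | c x \<noteq> 0 \<and> face j x = y. c x) \<noteq> 0"
    by (force elim: sum.not_neutral_contains_not_neutral)
  then obtain x where "c x \<noteq> 0" "face j x = y"
    by (force elim: sum.not_neutral_contains_not_neutral)
  with n j show thesis using that by simp
qed

text \<open>The cancellation behind the vanishing of a double boundary: for \<open>j \<le> i\<close>
  the term at \<open>(i, j)\<close> cancels against the one at \<open>(j, Suc i)\<close>, which
  carries the opposite sign.\<close>

lemma alternating_double_sum_zero:
  fixes T :: "nat \<Rightarrow> nat \<Rightarrow> real"
  assumes "\<And>i j. j \<le> i \<Longrightarrow> i \<le> m \<Longrightarrow> T i j = T j (Suc i)"
  shows "(\<Sum>i\<le>m. \<Sum>j\<le>Suc m. (-1) ^ (i + j) * T i j) = 0"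
proof -
  let ?t = "\<lambda>(i, j). (-1) ^ (i + j) * T i j"
  let ?L = "{(i, j). i \<le> m \<and> j \<le> i}" and ?U = "{(i, j). i < j \<and> j \<le> Suc m}"
  have fin: "finite ?L" "finite ?U"
    by (rule finite_subset[of _ "{..Suc m} \<times> {..Suc m}"]; force)+
  have pow: "(-1) ^ (a + b - Suc 0) = - ((-1) ^ (a + b) :: real)" if "a < b" for a b :: nat
    using that by (cases b) auto
  have "(\<Sum>i\<le>m. \<Sum>j\<le>Suc m. (-1) ^ (i + j) * T i j) = sum ?t ({..m} \<times> {..Suc m})"
    by (rule sum.cartesian_product)
  also have "{..m} \<times> {..Suc m} = ?L \<union> ?U" by auto
  also have "sum ?t (?L \<union> ?U) = sum ?t ?L + sum ?t ?U"
    by (intro sum.union_disjoint fin) auto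
  also have "sum ?t ?U = (\<Sum>p\<in>?L. - ?t p)"
    by (rule sum.reindex_bij_witness[of _ "\<lambda>(i, j). (j, Suc i)" "\<lambda>(i, j). (j - 1, i)"])
      (auto simp: assms add.commute pow)
  finally show ?thesis by (simp add: sum_negf)
qed

text \<open>The support of \<open>c\<close> may be infinite; finite fibres of the double faces over
  the point \<open>y\<close> permit the interchange of sums. The simplicial identity is required on
  the support, where tuples have the right length.\<close>

lemma boundary_op_boundary_op:
  assumes m: "m > 0"
    and simplicial: "\<And>i j x. j \<le> i \<Longrightarrow> i \<le> m \<Longrightarrow> c x \<noteq> 0 \<Longrightarrow> face i (face j x) = face j (face (Suc i) x)"
    and fin: "\<And>i j. i \<le> m \<Longrightarrow> j \<le> Suc m \<Longrightarrow> finite {x. c x \<noteq> 0 \<and> face i (face j x) = y}"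
  shows "boundary_op face m (boundary_op face (Suc m) c) y = 0"
proof -
  let ?b = "boundary_op face (Suc m) c"
  define X where "X i j = {x. c x \<noteq> 0 \<and> face i (face j x) = y}" for i j
  have inner: "(\<Sum>z | ?b z \<noteq> 0 \<and> face i z = y. ?b z) = (\<Sum>j\<le>Suc m. (-1) ^ j * sum c (X i j))"
    if i: "i \<le> m" for i
  proof -
    \<comment> \<open>A finite set of intermediate faces that contains every \<open>z\<close> over
      \<open>y\<close> at which the inner boundary is nonzero.\<close>
    define Z where "Z = (\<Union>j\<le>Suc m. face j ` X i j)"
    have finZ: "finite Z" using fin[OF i] by (auto simp: Z_def X_def)
    have Zy: "face i z = y" if "z \<in> Z" for z using that by (auto simp: Z_def X_def)
    have "(\<Sum>z | ?b z \<noteq> 0 \<and> face i z = y. ?b z) = sum ?b Z"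
    proof (rule sum.mono_neutral_left[OF finZ])
      show "{z. ?b z \<noteq> 0 \<and> face i z = y} \<subseteq> Z"
      proof clarify
        fix z assume "?b z \<noteq> 0" "y = face i z"
        then show "z \<in> Z"
          by (elim boundary_op_nonzeroE) (auto simp: Z_def X_def)
      qed
    qed (use Zy in auto)
    also have "\<dots> = (\<Sum>j\<le>Suc m. (-1) ^ j * (\<Sum>z\<in>Z. \<Sum>x | c x \<noteq> 0 \<and> face j x = z. c x))"
      unfolding sum_distrib_left by (subst sum.swap) (simp add: boundary_op_def sum_distrib_left)
    also have "\<dots> = (\<Sum>j\<le>Suc m. (-1) ^ j * sum c (X i j))"
    proof (intro sum.cong refl)
      fix j assume j: "j \<in> {..Suc m}"
      \<comment> \<open>The fibre of the double face is grouped by the intermediate face.\<close>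
      have "sum c (X i j) = (\<Sum>z\<in>Z. sum c {x \<in> X i j. face j x = z})"
        using fin[OF i] j finZ by (intro sum.group[symmetric]) (auto simp: X_def Z_def)
      also have "\<dots> = (\<Sum>z\<in>Z. \<Sum>x | c x \<noteq> 0 \<and> face j x = z. c x)"
        by (intro sum.cong refl) (auto simp: X_def dest: Zy)
      finally show "(-1) ^ j * (\<Sum>z\<in>Z. \<Sum>x | c x \<noteq> 0 \<and> face j x = z. c x) = (-1) ^ j * sum c (X i j)"
        by simp
    qed
    finally show ?thesis .
  qed
  have "boundary_op face m ?b y = (\<Sum>i\<le>m. (-1) ^ i * (\<Sum>j\<le>Suc m. (-1) ^ j * sum c (X i j)))"
    using m inner by (simp add: boundary_op_def[of face m])
  also have "\<dots> = (\<Sum>i\<le>m. \<Sum>j\<le>Suc m. (-1) ^ (i + j) * sum c (X i j))"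
    by (intro sum.cong refl) (subst sum_distrib_left, simp add: power_add mult.assoc)
  also have "\<dots> = 0"
  proof (rule alternating_double_sum_zero)
    fix i j :: nat assume "j \<le> i" "i \<le> m"
    then have "X i j = X j (Suc i)" using simplicial by (auto simp: X_def)
    then show "sum c (X i j) = sum c (X j (Suc i))" by simp
  qed
  finally show ?thesis .
qed

section \<open>Bar coordinates on tuples\<close>

lemma tuples_Suc: "x # xs \<in> tuples A (Suc n) \<longleftrightarrow> x \<in> A \<and> xs \<in> tuples A n"
  by (auto simp: tuples_def)

context group
begin

text \<open>The tuple \<open>(x, x g\<^sub>1, x g\<^sub>1 g\<^sub>2, \<dots>)\<close>: together with \<open>x\<close>, bar tuples coordinatise
  \<open>G\<^bsup>n+1\<^esup>\<close> compatibly with the left translation action.\<close>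

primrec path :: "'a \<Rightarrow> 'a list \<Rightarrow> 'a list" where
  "path x [] = [x]"
| "path x (g # gs) = x # path (x \<otimes> g) gs"

text \<open>Recovers the bar coordinates of a \<open>path\<close>; the remaining coordinate, the
  base point, is recovered by \<open>hd\<close>.\<close>

definition increments :: "'a list \<Rightarrow> 'a list" where
  "increments X = map2 (\<lambda>a b. inv a \<otimes> b) X (tl X)"

lemma hd_path [simp]: "hd (path x gs) = x"
  by (cases gs) auto

lemma increments_path:
  assumes "x \<in> carrier G" "set gs \<subseteq> carrier G"
  shows "increments (path x gs) = gs"
  using assms
proof (induction gs arbitrary: x)
  case (Cons g gs)
  then have "increments (path (x \<otimes> g) gs) = gs" by simp
  moreover obtain ys where "path (x \<otimes> g) gs = (x \<otimes> g) # ys" by (cases gs) auto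
  ultimately show ?case using Cons.prems
    by (simp add: increments_def m_assoc[symmetric])
qed (simp add: increments_def)

lemma path_inject:
  assumes "x \<in> carrier G" "set gs \<subseteq> carrier G" "y \<in> carrier G" "set hs \<subseteq> carrier G"
  shows "path x gs = path y hs \<longleftrightarrow> x = y \<and> gs = hs"
  using increments_path[OF assms(1,2)] increments_path[OF assms(3,4)] by (metis hd_path)

lemma path_in_tuples:
  "x \<in> carrier G \<Longrightarrow> gs \<in> tuples (carrier G) n \<Longrightarrow> path x gs \<in> tuples (carrier G) (Suc n)"
proof (induction gs arbitrary: x n)
  case (Cons g gs)
  then obtain m where "n = Suc m" by (auto simp: tuples_def)
  then show ?case using Cons by (simp add: tuples_Suc)
qed (auto simp: tuples_def)

lemma tuple_is_path:
  assumes "X \<in> tuples (carrier G) (Suc n)"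
  obtains x gs where "x \<in> carrier G" "gs \<in> tuples (carrier G) n" "X = path x gs"
proof -
  have "\<exists>x gs. x \<in> carrier G \<and> gs \<in> tuples (carrier G) n \<and> X = path x gs"
    using assms
  proof (induction n arbitrary: X)
    case 0
    then obtain x where "X = [x]" "x \<in> carrier G" by (auto simp: tuples_def length_Suc_conv)
    then show ?case by (intro exI[of _ x] exI[of _ "[]"]) (simp add: tuples_def)
  next
    case (Suc n)
    then obtain x Y where X: "X = x # Y" "x \<in> carrier G" "Y \<in> tuples (carrier G) (Suc n)"
      by (cases X) (auto simp: tuples_def)
    then obtain y gs where y: "y \<in> carrier G" "gs \<in> tuples (carrier G) n" "Y = path y gs"
      using Suc.IH by blast
    have "X = path x ((inv x \<otimes> y) # gs)" using X y by (simp add: m_assoc[symmetric])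
    then show ?case using X y by (metis tuples_Suc inv_closed m_closed)
  qed
  then show thesis using that by blast
qed

text \<open>Parametrises the preimages of \<open>gs\<close> under the \<open>j\<close>-th bar face
  by one group element: \<open>k\<close> is prepended for \<open>j = 0\<close>, appended for
  \<open>j = length gs + 1\<close>, and otherwise the \<open>j\<close>-th entry \<open>g\<close> is
  split into \<open>k\<close> and \<open>inv k \<otimes> g\<close>. The last equation is a default
  outside this range.\<close>

fun bar_insert :: "nat \<Rightarrow> 'a \<Rightarrow> 'a list \<Rightarrow> 'a list" where
  "bar_insert 0 k gs = k # gs"
| "bar_insert (Suc 0) k [] = [k]"
| "bar_insert (Suc 0) k (g # gs) = k # (inv k \<otimes> g) # gs"
| "bar_insert (Suc (Suc i)) k (g # gs) = g # bar_insert (Suc i) k gs"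
| "bar_insert (Suc (Suc i)) k [] = [k]"

lemma bar_insert_in_tuples:
  assumes "k \<in> carrier G" "gs \<in> tuples (carrier G) n" "j \<le> Suc n"
  shows "bar_insert j k gs \<in> tuples (carrier G) (Suc n)"
  using assms
proof (induction j k gs arbitrary: n rule: bar_insert.induct)
  case (4 i k g gs)
  then obtain m where "n = Suc m" by (cases n) (simp_all add: tuples_def)
  then show ?case using 4 by (simp add: tuples_Suc)
qed (auto simp: tuples_def)

section \<open>Bar faces, faces of paths and their preimages\<close>

lemma bar_face_0 [simp]: "bar_face G 0 (g # gs) = gs"
  and bar_face_1 [simp]: "bar_face G (Suc 0) [g] = []" "bar_face G (Suc 0) (g # h # gs) = (g \<otimes> h) # gs"
  by (simp_all add: bar_face_def)

lemma bar_face_Suc_Suc: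
  assumes "i < length gs"
  shows "bar_face G (Suc (Suc i)) (g # gs) = g # bar_face G (Suc i) gs"
  using assms by (auto simp: bar_face_def take_Cons' split: if_splits)

lemma bar_face_in_tuples:
  assumes "gs \<in> tuples (carrier G) (Suc n)" "j \<le> Suc n"
  shows "bar_face G j gs \<in> tuples (carrier G) n"
proof -
  have len: "length gs = Suc n" and sub: "set gs \<subseteq> carrier G" using assms by (auto simp: tuples_def)
  consider "j = 0" | "j = Suc n" | "0 < j" "j < Suc n" using assms(2) by linarith
  then show ?thesis
  proof cases
    case 1
    then show ?thesis using len sub by (cases gs) (auto simp: tuples_def)
  next
    case 2
    then show ?thesis using len sub by (auto simp: tuples_def bar_face_def dest: in_set_butlastD)
  next
    case 3
    then have "gs ! (j - 1) \<in> carrier G" "gs ! j \<in> carrier G" using len sub by auto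
    then show ?thesis using 3 len sub
      by (auto simp: tuples_def bar_face_def dest: in_set_takeD in_set_dropD)
  qed
qed

lemma bar_face_bar_insert:
  assumes "k \<in> carrier G" "set gs \<subseteq> carrier G" "j \<le> Suc (length gs)"
  shows "bar_face G j (bar_insert j k gs) = gs"
  using assms
proof (induction j k gs rule: bar_insert.induct)
  case (4 i k g gs)
  then have "bar_insert (Suc i) k gs \<in> tuples (carrier G) (Suc (length gs))"
    by (intro bar_insert_in_tuples) (auto simp: tuples_def)
  then have "length (bar_insert (Suc i) k gs) = Suc (length gs)" by (simp add: tuples_def)
  then show ?case using 4 by (simp add: bar_face_Suc_Suc)
qed (auto simp: m_assoc[symmetric])

text \<open>Every preimage under a face arises by insertion, and the inserted element stands at
  position \<open>j - 1\<close>. For \<open>j = 0\<close> truncated subtraction yields position 0,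
  which is again the right one.\<close>

lemma bar_insert_bar_face:
  assumes "set gs \<subseteq> carrier G" "j \<le> length gs" "gs \<noteq> []"
  shows "bar_insert j (gs ! (j - 1)) (bar_face G j gs) = gs"
  using assms
proof (induction gs arbitrary: j)
  case (Cons g gs)
  consider "j = 0" | "j = Suc 0" | i where "j = Suc (Suc i)" by (metis not0_implies_Suc)
  then show ?case
  proof cases
    case 2
    then show ?thesis using Cons.prems
      by (cases gs) (auto simp: m_assoc[symmetric])
  next
    case 3
    then have "i < length gs" using Cons.prems by simp
    moreover from this have "gs \<noteq> []" by auto
    moreover from calculation have "bar_insert (Suc i) (gs ! i) (bar_face G (Suc i) gs) = gs"
      using Cons.IH[of "Suc i"] Cons.prems by simp
    ultimately show ?thesis using 3 by (simp add: bar_face_Suc_Suc)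
  qed auto
qed simp

lemma inj_bar_insert: "inj_on (\<lambda>k. bar_insert j k gs) A"
proof (rule inj_onI)
  fix k l assume "bar_insert j k gs = bar_insert j l gs"
  then show "k = l"
    by (induction j k gs rule: bar_insert.induct) auto
qed

text \<open>Deleting the first vertex is the one face that moves the base point: after its first
  vertex, \<open>path (x \<otimes> inv k) (k # gs)\<close> continues as
  \<open>path x gs\<close>.\<close>

definition base_shift :: "nat \<Rightarrow> 'a \<Rightarrow> 'a \<Rightarrow> 'a" where
  "base_shift j x k = (if j = 0 then x \<otimes> inv k else x)"

text \<open>Omitting an inner vertex multiplies the two increments meeting there, omitting the last
  vertex drops the last increment, and omitting the first one drops the first increment and moves
  the base point along it.\<close>

lemma delete_face_path:
  assumes "x \<in> carrier G" "set gs \<subseteq> carrier G" "j \<le> length gs" "gs \<noteq> []"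
  shows "delete_face j (path x gs) = path (if j = 0 then x \<otimes> hd gs else x) (bar_face G j gs)"
  using assms
proof (induction gs arbitrary: x j)
  case (Cons g gs)
  consider "j = 0" | "j = Suc 0" | i where "j = Suc (Suc i)" by (metis not0_implies_Suc)
  then show ?case
  proof cases
    case 2
    then show ?thesis using Cons.prems
      by (cases gs) (auto simp: m_assoc delete_face_def)
  next
    case 3
    then have i: "i < length gs" "gs \<noteq> []" using Cons.prems by auto
    have "delete_face j (path x (g # gs)) = x # delete_face (Suc i) (path (x \<otimes> g) gs)"
      using 3 by (simp add: delete_face_def)
    then show ?thesis using Cons i 3 by (simp add: bar_face_Suc_Suc)
  qed (simp add: delete_face_def)
qed simp

lemma delete_face_path_bar_insert:
  assumes "x \<in> carrier G" "k \<in> carrier G" "gs \<in> tuples (carrier G) n" "j \<le> Suc n"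
  shows "delete_face j (path (base_shift j x k) (bar_insert j k gs)) = path x gs"
proof -
  have t: "bar_insert j k gs \<in> tuples (carrier G) (Suc n)"
    by (rule bar_insert_in_tuples) (use assms in auto)
  then have "bar_insert j k gs \<noteq> []" "j \<le> length (bar_insert j k gs)"
    "set (bar_insert j k gs) \<subseteq> carrier G"
    using assms by (auto simp: tuples_def)
  then have "delete_face j (path (base_shift j x k) (bar_insert j k gs)) =
    path (if j = 0 then base_shift j x k \<otimes> hd (bar_insert j k gs) else base_shift j x k)
      (bar_face G j (bar_insert j k gs))"
    using assms by (intro delete_face_path) (auto simp: base_shift_def)
  also have "bar_face G j (bar_insert j k gs) = gs"
    using assms by (intro bar_face_bar_insert) (auto simp: tuples_def)
  finally show ?thesis using assms by (auto simp: base_shift_def m_assoc)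
qed

text \<open>Together with the preceding lemma this describes the fibre of a vertex deletion over
  \<open>path x gs\<close>: its members are determined by the inserted increment.\<close>

lemma delete_face_eq_pathE:
  assumes "X \<in> tuples (carrier G) (Suc (Suc n))" "delete_face j X = path x gs"
    and "x \<in> carrier G" "gs \<in> tuples (carrier G) n" "j \<le> Suc n"
  shows "X = path (base_shift j x (increments X ! (j - 1))) (bar_insert j (increments X ! (j - 1)) gs)"
proof -
  obtain y hs where y: "y \<in> carrier G" "hs \<in> tuples (carrier G) (Suc n)" and X: "X = path y hs"
    using tuple_is_path[OF assms(1)] by blast
  have hs: "set hs \<subseteq> carrier G" "length hs = Suc n" "hs \<noteq> []" using y by (auto simp: tuples_def)
  have inc: "increments X = hs" unfolding X by (rule increments_path) (use y hs in auto)
  have "path (if j = 0 then y \<otimes> hd hs else y) (bar_face G j hs) = path x gs"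
    using delete_face_path[of y hs j] assms(2,5) y hs by (simp add: X)
  moreover have "bar_face G j hs \<in> tuples (carrier G) n"
    by (rule bar_face_in_tuples) (use y assms in auto)
  moreover have "(if j = 0 then y \<otimes> hd hs else y) \<in> carrier G"
    using y hs by (cases hs) auto
  ultimately have *: "(if j = 0 then y \<otimes> hd hs else y) = x" "bar_face G j hs = gs"
    using path_inject[of "if j = 0 then y \<otimes> hd hs else y" "bar_face G j hs" x gs] assms
    by (auto simp: tuples_def)
  have "base_shift j x (hs ! (j - 1)) = y"
    using *(1) hs(1,3) y(1) by (cases hs) (auto simp: base_shift_def m_assoc split: if_splits)
  moreover have "bar_insert j (hs ! (j - 1)) gs = hs"
    using bar_insert_bar_face[of hs j] * hs assms by simp
  ultimately show ?thesis unfolding inc by (simp add: X)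
qed

text \<open>The inserted element is an entry of the larger tuple and so lies in \<open>K\<close>. A
  sum over the fixed set \<open>K\<close> can be compared term by term with
  \<open>uf_boundary_path\<close>.\<close>

lemma bar_boundary_eq:
  assumes c: "\<And>X. c X \<noteq> 0 \<Longrightarrow> X \<in> tuples (carrier G) (Suc n) \<and> set X \<subseteq> K"
    and K: "finite K" "K \<subseteq> carrier G" and gs: "gs \<in> tuples (carrier G) n"
  shows "boundary_op (bar_face G) (Suc n) c gs = (\<Sum>j\<le>Suc n. (-1) ^ j * (\<Sum>k\<in>K. c (bar_insert j k gs)))"
proof (rule boundary_op_eq_sum)
  fix j k assume "j \<le> Suc n" "k \<in> K"
  then show "bar_face G j (bar_insert j k gs) = gs"
    using K gs by (intro bar_face_bar_insert) (auto simp: tuples_def)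
next
  fix j X assume *: "j \<le> Suc n" "c X \<noteq> 0" "bar_face G j X = gs"
  then have X: "set X \<subseteq> carrier G" "length X = Suc n" "set X \<subseteq> K" using c[of X] by (auto simp: tuples_def)
  then have "X = bar_insert j (X ! (j - 1)) gs"
    using bar_insert_bar_face[of X j] * by (cases X) auto
  moreover have "X ! (j - 1) \<in> K"
    using X *(1) nth_mem[of "j - 1" X] by auto
  ultimately show "X \<in> (\<lambda>k. bar_insert j k gs) ` K" by (rule image_eqI)
qed (use K inj_bar_insert in auto)

section \<open>Cycles and boundaries of the bar complex\<close>

lemma bar_boundary_support:
  assumes "c \<in> bar_chains G (Suc n)" "boundary_op (bar_face G) (Suc n) c gs \<noteq> 0"
  shows "gs \<in> tuples (carrier G) n"
  using assms(2)
proof (rule boundary_op_nonzeroE)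
  fix j X assume *: "j \<le> Suc n" "c X \<noteq> 0" "bar_face G j X = gs"
  then have "X \<in> tuples (carrier G) (Suc n)" using assms(1) by (auto simp: bar_chains_def)
  then show ?thesis using * bar_face_in_tuples by blast
qed

lemma finite_support_fibre: "c \<in> bar_chains G m \<Longrightarrow> finite {x. c x \<noteq> 0 \<and> P x}"
  by (auto simp: bar_chains_def intro: finite_subset)

lemma function_subspace_bar_chains: "function_subspace (bar_chains G n)"
proof (rule function_subspaceI)
  fix f g assume "f \<in> bar_chains G n" "g \<in> bar_chains G n"
  then show "(\<lambda>x. f x + g x) \<in> bar_chains G n"
    by (auto simp: bar_chains_def intro: finite_subset[of _ "{x. f x \<noteq> 0} \<union> {x. g x \<noteq> 0}"])
qed (auto simp: bar_chains_def)

lemma function_subspace_bar_boundaries: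
  "function_subspace (boundary_space (bar_chains G) (boundary_op (bar_face G)) n)"
  (is "function_subspace ?B")
proof (rule function_subspaceI)
  note S = function_subspace_bar_chains[of "Suc n"]
  show "(\<lambda>x. 0) \<in> ?B"
    unfolding boundary_space_def
    by (rule image_eqI[OF _ function_subspace_zero[OF S]]) (simp add: boundary_op_def fun_eq_iff)
  fix f r assume "f \<in> ?B"
  then obtain c where c: "c \<in> bar_chains G (Suc n)" "f = boundary_op (bar_face G) (Suc n) c"
    by (auto simp: boundary_space_def)
  show "(\<lambda>x. r * f x) \<in> ?B"
    unfolding boundary_space_def
    by (rule image_eqI[OF _ function_subspace_scale[OF S c(1)]]) (simp add: c boundary_op_scale)
  fix g assume "g \<in> ?B"
  then obtain e where e: "e \<in> bar_chains G (Suc n)" "g = boundary_op (bar_face G) (Suc n) e"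
    by (auto simp: boundary_space_def)
  show "(\<lambda>x. f x + g x) \<in> ?B"
    unfolding boundary_space_def c(2) e(2)
    by (rule image_eqI[OF _ function_subspace_add[OF S c(1) e(1)]], rule boundary_op_add[symmetric])
      (use c e finite_support_fibre in auto)
qed

text \<open>The inclusion of a subgroup is the identity on the ambient type, so the chain map it
  induces leaves functions unchanged.\<close>

lemma bar_map_id: "bar_map (\<lambda>h. h) c = c"
proof
  fix y
  have "{x. c x \<noteq> 0 \<and> x = y} = (if c y \<noteq> 0 then {y} else {})" by auto
  then show "bar_map (\<lambda>h. h) c y = c y" by (simp add: bar_map_def)
qed

text \<open>If a representative of \<alpha> bounded in \<open>G\<close>, then so would every other
  one, as they differ by boundaries of \<open>H\<close>, and the image of \<alpha> would be the zero
  class.\<close>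

lemma nontrivial_homology_mapE:
  assumes H: "subgroup H G"
    and "\<alpha> \<in> carrier (group_homology (G\<lparr>carrier := H\<rparr>) n)"
    and nz: "group_homology_map G n (\<lambda>h. h) \<alpha> \<noteq> \<zero>\<^bsub>group_homology G n\<^esub>"
  obtains z where "z \<in> bar_chains G n" "\<And>X. z X \<noteq> 0 \<Longrightarrow> X \<in> tuples H n"
    "boundary_op (bar_face G) n z = (\<lambda>x. 0)"
    "z \<notin> boundary_space (bar_chains G) (boundary_op (bar_face G)) n"
proof -
  let ?H = "G\<lparr>carrier := H\<rparr>"
  let ?B = "boundary_space (bar_chains G) (boundary_op (bar_face G)) n"
  let ?BH = "boundary_space (bar_chains ?H) (boundary_op (bar_face ?H)) n"
  let ?ZH = "cycle_space (bar_chains ?H) (boundary_op (bar_face ?H)) n"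
  note B = function_subspace_bar_boundaries[of n]
  have HG: "H \<subseteq> carrier G" using H by (rule subgroup.subset)
  \<comment> \<open>\<open>bar_face\<close> looks only at the multiplication, which restricting the
    carrier leaves alone.\<close>
  have face: "bar_face ?H = bar_face G" by (simp add: bar_face_def fun_eq_iff)
  have sub: "bar_chains ?H m \<subseteq> bar_chains G m" for m
  proof -
    have "tuples H m \<subseteq> tuples (carrier G) m" using HG by (auto simp: tuples_def)
    then show ?thesis by (auto simp: bar_chains_def)
  qed
  interpret H: group ?H using H by (rule subgroup_imp_group)
  have BHB: "?BH \<subseteq> ?B" using sub by (auto simp: boundary_space_def face)
  obtain z where z: "z \<in> ?ZH" and \<alpha>: "\<alpha> = coset ?BH z"
    using assms(2) unfolding group_homology_def homology_def quotient_space_def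
    by (auto simp: A_RCOSETS_def' coset_fun_space) (auto simp: fun_space_def)
  have "z \<notin> ?B"
  proof
    assume zB: "z \<in> ?B"
    have "coset ?B c = ?B" if "c \<in> \<alpha>" for c
    proof -
      from that have "(\<lambda>x. c x - z x) \<in> ?B" using BHB by (auto simp: \<alpha> mem_coset_iff)
      from function_subspace_add[OF B this zB] have "c \<in> ?B" by simp
      then have "coset ?B c = coset ?B (\<lambda>x. 0)" by (simp add: coset_eq_iff[OF B])
      then show ?thesis by (simp add: coset_zero)
    qed
    moreover have "z \<in> \<alpha>"
      by (simp add: \<alpha> mem_coset_iff function_subspace_zero[OF H.function_subspace_bar_boundaries])
    ultimately have "group_homology_map G n (\<lambda>h. h) \<alpha> = ?B"
      by (auto simp: group_homology_map_def homology_map_def coset_fun_space bar_map_id)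
    with nz show False by (simp add: group_homology_def homology_def quotient_space_def)
  qed
  moreover have "z \<in> bar_chains ?H n" using z by (simp add: cycle_space_def)
  moreover have "boundary_op (bar_face G) n z = (\<lambda>x. 0)" using z by (simp add: cycle_space_def face)
  ultimately show thesis using that[of z] sub by (auto simp: bar_chains_def)
qed

end

section \<open>Uniformly finite chains on groups with finite balls\<close>

lemma delete_face_delete_face:
  assumes "j \<le> i" "i < length xs"
  shows "delete_face i (delete_face j xs) = delete_face j (delete_face (Suc i) xs)"
  using assms
proof (induction xs arbitrary: i j)
  case (Cons x xs)
  then show ?case
    by (cases i; cases j) (simp_all add: delete_face_def)
qed simp

lemma length_delete_face: "j < length xs \<Longrightarrow> length (delete_face j xs) = length xs - 1"
  by (simp add: delete_face_def)

lemma set_delete_face: "set (delete_face j xs) \<subseteq> set xs"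
  by (auto simp: delete_face_def dest: in_set_takeD in_set_dropD)

lemma delete_face_in_tuples:
  "X \<in> tuples A (Suc n) \<Longrightarrow> j \<le> n \<Longrightarrow> delete_face j X \<in> tuples A n"
  using set_delete_face[of j X] by (auto simp: tuples_def length_delete_face)

text \<open>For the empty list \<open>Max\<close> would be applied to the empty set, where its value
  is unspecified.\<close>

lemma tuple_diam_le_iff:
  assumes "x \<noteq> []"
  shows "tuple_diam d x \<le> R \<longleftrightarrow> (\<forall>a\<in>set x. \<forall>b\<in>set x. d a b \<le> R)"
  using assms unfolding tuple_diam_def
  by (subst Max_le_iff) (auto simp: all_set_conv_all_nth lessThan_empty_iff)

text \<open>Isolates finiteness of balls, the property of word lengths from which the finiteness
  statements below follow. The distance \<open>len (inv g \<otimes> h)\<close> is left invariant by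
  its form.\<close>

locale proper_length_group = group G for G (structure) +
  fixes len :: "'a \<Rightarrow> real"
  assumes finite_balls: "finite {g \<in> carrier G. len g \<le> R}"
begin

abbreviation uf :: "nat \<Rightarrow> ('a list \<Rightarrow> real) set" where
  "uf \<equiv> uf_chains (carrier G) (\<lambda>g h. len (inv g \<otimes> h))"

abbreviation uf_bd :: "nat \<Rightarrow> ('a list \<Rightarrow> real) \<Rightarrow> 'a list \<Rightarrow> real" where
  "uf_bd \<equiv> boundary_op delete_face"

text \<open>A tuple near \<open>y\<close> arises from \<open>y\<close> by multiplying each entry by
  the inverse of an element of a fixed finite ball, and the number of choices does not depend on
  \<open>y\<close>. \<open>P\<close> stands for nonvanishing of a chain.\<close>

lemma tuples_ball_bound:
  obtains K where "K > (0::nat)"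
    "\<And>y. y \<in> tuples (carrier G) m \<Longrightarrow>
      finite {x \<in> tuples (carrier G) m. max_dist (\<lambda>g h. len (inv g \<otimes> h)) x y < r \<and> P x} \<and>
      card {x \<in> tuples (carrier G) m. max_dist (\<lambda>g h. len (inv g \<otimes> h)) x y < r \<and> P x} \<le> K"
proof -
  let ?b = "{g \<in> carrier G. len g \<le> r}"
  let ?L = "{bs. set bs \<subseteq> ?b \<and> length bs = m}"
  have L: "finite ?L" by (rule finite_lists_length_eq[OF finite_balls])
  show thesis
  \<comment> \<open>\<open>Suc\<close> makes the bound positive.\<close>
  proof (rule that[of "Suc (card ?L)"])
    fix y assume y: "y \<in> tuples (carrier G) m"
    let ?S = "{x \<in> tuples (carrier G) m. max_dist (\<lambda>g h. len (inv g \<otimes> h)) x y < r \<and> P x}"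
    have sub: "?S \<subseteq> map2 (\<lambda>a k. a \<otimes> inv k) y ` ?L"
    proof
      fix x assume "x \<in> ?S"
      then have x: "set x \<subseteq> carrier G" "length x = m"
        and d: "max_dist (\<lambda>g h. len (inv g \<otimes> h)) x y < r"
        by (auto simp: tuples_def)
      have y': "set y \<subseteq> carrier G" "length y = m" using y by (auto simp: tuples_def)
      have in_G: "x ! i \<in> carrier G" "y ! i \<in> carrier G" if "i < m" for i
        using that x y' nth_mem by (metis subsetD)+
      have "len (inv (x ! i) \<otimes> y ! i) < r" if "i < m" for i
      proof -
        have "len (inv (x ! i) \<otimes> y ! i) \<le> max_dist (\<lambda>g h. len (inv g \<otimes> h)) x y"
          unfolding max_dist_def using that x by (intro Max_ge) auto
        then show ?thesis using d by simp
      qed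
      then have "map2 (\<lambda>g h. inv g \<otimes> h) x y \<in> ?L"
        using x y' in_G by (auto simp: set_zip less_imp_le)
      moreover have "x = map2 (\<lambda>a k. a \<otimes> inv k) y (map2 (\<lambda>g h. inv g \<otimes> h) x y)"
        using x y' in_G
        by (intro nth_equalityI) (simp_all add: inv_mult_group m_assoc[symmetric])
      ultimately show "x \<in> map2 (\<lambda>a k. a \<otimes> inv k) y ` ?L" by blast
    qed
    have "finite ?S" "card ?S \<le> card (map2 (\<lambda>a k. a \<otimes> inv k) y ` ?L)"
      by (rule finite_subset[OF sub finite_imageI[OF L]], rule card_mono[OF finite_imageI[OF L] sub])
    then show "finite ?S \<and> card ?S \<le> Suc (card ?L)"
      using card_image_le[OF L, of "map2 (\<lambda>a k. a \<otimes> inv k) y"] by linarith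
  qed simp
qed

text \<open>The counting condition on balls holds for every function by
  \<open>tuples_ball_bound\<close>, so support, boundedness and diameter characterise the
  chains.\<close>

lemma uf_chains_iff:
  "c \<in> uf n \<longleftrightarrow> (\<forall>x. c x \<noteq> 0 \<longrightarrow> x \<in> tuples (carrier G) (Suc n)) \<and> (\<exists>B. \<forall>x. \<bar>c x\<bar> \<le> B) \<and>
     (\<exists>R. \<forall>x. c x \<noteq> 0 \<longrightarrow> (\<forall>a\<in>set x. \<forall>b\<in>set x. len (inv a \<otimes> b) \<le> R))"
  (is "_ \<longleftrightarrow> ?supp \<and> ?bdd \<and> ?diam")
proof
  assume c: "c \<in> uf n"
  have supp: ?supp using c unfolding uf_chains_def Suc_eq_plus1 by blast
  obtain B where B: "\<And>x. x \<in> tuples (carrier G) (Suc n) \<Longrightarrow> \<bar>c x\<bar> \<le> B"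
    using c unfolding uf_chains_def Suc_eq_plus1 by blast
  obtain R where R: "\<And>x. x \<in> tuples (carrier G) (Suc n) \<Longrightarrow>
      tuple_diam (\<lambda>g h. len (inv g \<otimes> h)) x > R \<Longrightarrow> c x = 0"
    using c unfolding uf_chains_def Suc_eq_plus1 by blast
  have "\<bar>c x\<bar> \<le> max B 0" for x using supp B[of x] by (cases "c x = 0") (auto simp: le_max_iff_disj)
  moreover have "len (inv a \<otimes> b) \<le> R" if "c x \<noteq> 0" "a \<in> set x" "b \<in> set x" for x a b
  proof -
    have "tuple_diam (\<lambda>g h. len (inv g \<otimes> h)) x \<le> R" using R[of x] supp that(1) by force
    then show ?thesis using that by (subst (asm) tuple_diam_le_iff) auto
  qed
  ultimately show "?supp \<and> ?bdd \<and> ?diam" using supp by blast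
next
  assume *: "?supp \<and> ?bdd \<and> ?diam"
  then obtain R where R: "\<And>x a b. c x \<noteq> 0 \<Longrightarrow> a \<in> set x \<Longrightarrow> b \<in> set x \<Longrightarrow> len (inv a \<otimes> b) \<le> R"
    by blast
  \<comment> \<open>The definition asks for a positive bound on the diameter, hence
    \<open>max R 1\<close>.\<close>
  have "c x = 0" if "x \<in> tuples (carrier G) (n + 1)" "tuple_diam (\<lambda>g h. len (inv g \<otimes> h)) x > max R 1" for x
  proof (rule ccontr)
    assume "c x \<noteq> 0"
    then have "tuple_diam (\<lambda>g h. len (inv g \<otimes> h)) x \<le> R"
      using that(1) R by (subst tuple_diam_le_iff) (auto simp: tuples_def)
    with that(2) show False by simp
  qed
  then have diam: "\<exists>R>0. \<forall>x\<in>tuples (carrier G) (n + 1). tuple_diam (\<lambda>g h. len (inv g \<otimes> h)) x > R \<longrightarrow> c x = 0"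
    by (intro exI[of _ "max R 1"]) auto
  have ball: "\<exists>K>0. \<forall>y\<in>tuples (carrier G) (n + 1).
      finite {x \<in> tuples (carrier G) (n + 1). max_dist (\<lambda>g h. len (inv g \<otimes> h)) x y < r \<and> c x \<noteq> 0} \<and>
      card {x \<in> tuples (carrier G) (n + 1). max_dist (\<lambda>g h. len (inv g \<otimes> h)) x y < r \<and> c x \<noteq> 0} \<le> K" for r
    by (rule tuples_ball_bound[of "n + 1" r "\<lambda>x. c x \<noteq> 0"]) blast
  have supp: "\<forall>x. x \<notin> tuples (carrier G) (n + 1) \<longrightarrow> c x = 0"
    using * unfolding Suc_eq_plus1 by blast
  obtain B where "\<And>x. \<bar>c x\<bar> \<le> B" using * by blast
  then have bdd: "\<exists>B. \<forall>x\<in>tuples (carrier G) (n + 1). \<bar>c x\<bar> \<le> B" by (intro exI ballI)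
  show "c \<in> uf n"
    unfolding uf_chains_def mem_Collect_eq using ball by (intro conjI supp bdd diam) simp
qed

section \<open>Supports and fibres of uniformly finite chains\<close>

lemma uf_support: "c \<in> uf n \<Longrightarrow> c x \<noteq> 0 \<Longrightarrow> x \<in> tuples (carrier G) (Suc n)"
  by (simp add: uf_chains_iff)

lemma uf_boundedE:
  assumes "c \<in> uf n"
  obtains B where "B \<ge> 0" "\<And>x. \<bar>c x\<bar> \<le> B"
  using assms by (auto simp: uf_chains_iff) (meson abs_ge_zero order_trans)

lemma uf_diamE:
  assumes "c \<in> uf n"
  obtains R where "\<And>x a b. c x \<noteq> 0 \<Longrightarrow> a \<in> set x \<Longrightarrow> b \<in> set x \<Longrightarrow> len (inv a \<otimes> b) \<le> R"
  using assms unfolding uf_chains_iff by blast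

lemma function_subspace_uf: "function_subspace (uf n)"
proof (rule function_subspaceI)
  fix f g assume f: "f \<in> uf n" and g: "g \<in> uf n"
  obtain B where B: "\<And>x. \<bar>f x\<bar> \<le> B" using uf_boundedE[OF f] by metis
  obtain C where C: "\<And>x. \<bar>g x\<bar> \<le> C" using uf_boundedE[OF g] by metis
  obtain R where R: "\<And>x a b. f x \<noteq> 0 \<Longrightarrow> a \<in> set x \<Longrightarrow> b \<in> set x \<Longrightarrow> len (inv a \<otimes> b) \<le> R"
    using uf_diamE[OF f] by metis
  obtain S where S: "\<And>x a b. g x \<noteq> 0 \<Longrightarrow> a \<in> set x \<Longrightarrow> b \<in> set x \<Longrightarrow> len (inv a \<otimes> b) \<le> S"
    using uf_diamE[OF g] by metis
  have nz: "f x \<noteq> 0 \<or> g x \<noteq> 0" if "f x + g x \<noteq> 0" for x using that by auto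
  show "(\<lambda>x. f x + g x) \<in> uf n"
    unfolding uf_chains_iff
  proof (intro conjI exI allI impI ballI)
    fix x assume "f x + g x \<noteq> 0"
    then show "x \<in> tuples (carrier G) (Suc n)" using nz uf_support f g by blast
  next
    fix x show "\<bar>f x + g x\<bar> \<le> B + C" using B[of x] C[of x] by linarith
  next
    fix x a b assume "f x + g x \<noteq> 0" "a \<in> set x" "b \<in> set x"
    then show "len (inv a \<otimes> b) \<le> max R S"
      using nz[of x] R[of x a b] S[of x a b] unfolding le_max_iff_disj by blast
  qed
next
  fix r f assume f: "f \<in> uf n"
  obtain B where B: "\<And>x. \<bar>f x\<bar> \<le> B" using uf_boundedE[OF f] by metis
  have "\<bar>r * f x\<bar> \<le> \<bar>r\<bar> * B" for x using B[of x] by (simp add: abs_mult mult_left_mono)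
  moreover obtain R where "\<And>x a b. f x \<noteq> 0 \<Longrightarrow> a \<in> set x \<Longrightarrow> b \<in> set x \<Longrightarrow> len (inv a \<otimes> b) \<le> R"
    using uf_diamE[OF f] by metis
  ultimately show "(\<lambda>x. r * f x) \<in> uf n"
    unfolding uf_chains_iff using uf_support[OF f] by (metis mult_zero_right)
qed (auto simp: uf_chains_iff)

text \<open>Bounded diameter confines all vertices of such a tuple to one finite ball around
  \<open>a\<close>.\<close>

lemma finite_uf_support_through:
  assumes c: "c \<in> uf n"
  shows "finite {x. c x \<noteq> 0 \<and> a \<in> set x}"
proof -
  obtain R where R: "\<And>x a b. c x \<noteq> 0 \<Longrightarrow> a \<in> set x \<Longrightarrow> b \<in> set x \<Longrightarrow> len (inv a \<otimes> b) \<le> R"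
    using uf_diamE[OF c] by metis
  let ?A = "(\<lambda>k. a \<otimes> k) ` {g \<in> carrier G. len g \<le> R}"
  have "{x. c x \<noteq> 0 \<and> a \<in> set x} \<subseteq> {x. set x \<subseteq> ?A \<and> length x = Suc n}"
  proof
    fix x assume "x \<in> {x. c x \<noteq> 0 \<and> a \<in> set x}"
    then have x: "c x \<noteq> 0" "a \<in> set x" by auto
    then have t: "set x \<subseteq> carrier G" "length x = Suc n" using uf_support[OF c] by (auto simp: tuples_def)
    have "b \<in> ?A" if "b \<in> set x" for b
    proof
      have "a \<in> carrier G" "b \<in> carrier G" using t x that by blast+
      then show "b = a \<otimes> (inv a \<otimes> b)" "inv a \<otimes> b \<in> {g \<in> carrier G. len g \<le> R}"
        using R[OF x that] by (simp_all add: m_assoc[symmetric])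
    qed
    with t show "x \<in> {x. set x \<subseteq> ?A \<and> length x = Suc n}" by blast
  qed
  then show ?thesis by (rule finite_subset) (intro finite_lists_length_eq finite_imageI finite_balls)
qed

text \<open>For \<open>n > 0\<close> a face is nonempty, and its head is a vertex of every tuple in
  the fibre.\<close>

lemma finite_uf_fibre:
  assumes c: "c \<in> uf n" and "n > 0" "j \<le> n"
  shows "finite {x. c x \<noteq> 0 \<and> delete_face j x = y}"
proof (rule finite_subset[OF _ finite_uf_support_through[OF c, of "hd y"]], rule subsetI)
  fix x assume "x \<in> {x. c x \<noteq> 0 \<and> delete_face j x = y}"
  then have x: "c x \<noteq> 0" "y = delete_face j x" by auto
  then have "length x = Suc n" using uf_support[OF c] by (auto simp: tuples_def)
  then have "delete_face j x \<noteq> []" using length_delete_face[of j x] assms by auto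
  then show "x \<in> {x. c x \<noteq> 0 \<and> hd y \<in> set x}" using x set_delete_face[of j x] hd_in_set by blast
qed

lemma in_set_incrementsD:
  assumes "g \<in> set (increments X)"
  obtains a b where "a \<in> set X" "b \<in> set X" "g = inv a \<otimes> b"
proof -
  obtain a b where ab: "(a, b) \<in> set (zip X (tl X))" "g = inv a \<otimes> b"
    using assms by (auto simp: increments_def)
  moreover have "set (tl X) \<subseteq> set X" by (cases X) auto
  ultimately show thesis using that set_zip_leftD[OF ab(1)] set_zip_rightD[OF ab(1)] by blast
qed

text \<open>Bounded diameter puts all increments into one finite ball. In bar coordinates a chain
  therefore involves only finitely many bar tuples.\<close>

lemma uf_incrementsE:
  assumes c: "c \<in> uf n"
  obtains K where "finite K" "K \<subseteq> carrier G" "\<And>X. c X \<noteq> 0 \<Longrightarrow> set (increments X) \<subseteq> K"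
proof -
  obtain R where R: "\<And>x a b. c x \<noteq> 0 \<Longrightarrow> a \<in> set x \<Longrightarrow> b \<in> set x \<Longrightarrow> len (inv a \<otimes> b) \<le> R"
    using uf_diamE[OF c] by metis
  show thesis
  proof (rule that[of "{g \<in> carrier G. len g \<le> R}"])
    fix X assume X: "c X \<noteq> 0"
    then have "set X \<subseteq> carrier G" using uf_support[OF c] by (auto simp: tuples_def)
    then show "set (increments X) \<subseteq> {g \<in> carrier G. len g \<le> R}"
      using R[OF X] by (auto elim!: in_set_incrementsD)
  qed (use finite_balls in auto)
qed

text \<open>The counterpart of \<open>bar_boundary_eq\<close>: the same insertions occur, and the
  base point shift in the 0-th face is the one difference.\<close>

lemma uf_boundary_path:
  assumes c: "\<And>X. c X \<noteq> 0 \<Longrightarrow> X \<in> tuples (carrier G) (Suc (Suc n)) \<and> set (increments X) \<subseteq> K"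
    and K: "finite K" "K \<subseteq> carrier G" and x: "x \<in> carrier G" and gs: "gs \<in> tuples (carrier G) n"
  shows "uf_bd (Suc n) c (path x gs) =
    (\<Sum>j\<le>Suc n. (-1) ^ j * (\<Sum>k\<in>K. c (path (base_shift j x k) (bar_insert j k gs))))"
proof (rule boundary_op_eq_sum)
  fix j assume j: "j \<le> Suc n"
  have base: "base_shift j x k \<in> carrier G" if "k \<in> K" for k
    using K x that by (auto simp: base_shift_def)
  have ins: "set (bar_insert j k gs) \<subseteq> carrier G" if "k \<in> K" for k
    using bar_insert_in_tuples[OF _ gs j, of k] K that by (auto simp: tuples_def)
  show "inj_on (\<lambda>k. path (base_shift j x k) (bar_insert j k gs)) K"
  proof (rule inj_onI)
    fix k l assume "k \<in> K" "l \<in> K"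
      "path (base_shift j x k) (bar_insert j k gs) = path (base_shift j x l) (bar_insert j l gs)"
    then have "bar_insert j k gs = bar_insert j l gs"
      using path_inject base ins by blast
    then show "k = l" using inj_bar_insert[of j gs UNIV] by (simp add: inj_on_def)
  qed
  fix X assume X: "c X \<noteq> 0" "delete_face j X = path x gs"
  then have "X = path (base_shift j x (increments X ! (j - 1))) (bar_insert j (increments X ! (j - 1)) gs)"
    using c gs x j by (intro delete_face_eq_pathE) auto
  moreover have "length (increments X) = Suc n"
    using c[OF X(1)] by (auto simp: increments_def tuples_def)
  then have "increments X ! (j - 1) \<in> K"
    using c[OF X(1)] j nth_mem[of "j - 1" "increments X"] by auto
  ultimately show "X \<in> (\<lambda>k. path (base_shift j x k) (bar_insert j k gs)) ` K" by (rule image_eqI)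
next
  fix j k assume "j \<le> Suc n" "k \<in> K"
  then show "delete_face j (path (base_shift j x k) (bar_insert j k gs)) = path x gs"
    using K x gs by (intro delete_face_path_bar_insert) auto
qed (use K in auto)

text \<open>A coefficient of the boundary collects at most \<open>card K\<close> coefficients of
  \<open>c\<close> from each of the \<open>n + 2\<close> faces, and passing to a face does not
  enlarge the diameter.\<close>

lemma uf_boundary_in_uf:
  assumes c: "c \<in> uf (Suc n)"
  shows "uf_bd (Suc n) c \<in> uf n"
proof -
  obtain B where B: "B \<ge> 0" "\<And>x. \<bar>c x\<bar> \<le> B" using uf_boundedE[OF c] by metis
  obtain R where R: "\<And>x a b. c x \<noteq> 0 \<Longrightarrow> a \<in> set x \<Longrightarrow> b \<in> set x \<Longrightarrow> len (inv a \<otimes> b) \<le> R"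
    using uf_diamE[OF c] by metis
  obtain K where K: "finite K" "K \<subseteq> carrier G" "\<And>X. c X \<noteq> 0 \<Longrightarrow> set (increments X) \<subseteq> K"
    using uf_incrementsE[OF c] by metis
  have supp: "y \<in> tuples (carrier G) (Suc n)" if "uf_bd (Suc n) c y \<noteq> 0" for y
    using that
  proof (rule boundary_op_nonzeroE)
    fix j x assume "j \<le> Suc n" "c x \<noteq> 0" "delete_face j x = y"
    then show "y \<in> tuples (carrier G) (Suc n)"
      using delete_face_in_tuples uf_support[OF c] by blast
  qed
  show ?thesis
    unfolding uf_chains_iff
  proof (intro conjI exI allI impI ballI)
    fix y show "\<bar>uf_bd (Suc n) c y\<bar> \<le> real (Suc (Suc n)) * (real (card K) * B)"
    proof (cases "uf_bd (Suc n) c y = 0")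
      case False
      then obtain x gs where y: "x \<in> carrier G" "gs \<in> tuples (carrier G) n" "y = path x gs"
        using supp tuple_is_path by metis
      have "\<bar>uf_bd (Suc n) c y\<bar>
          = \<bar>\<Sum>j\<le>Suc n. (-1) ^ j * (\<Sum>k\<in>K. c (path (base_shift j x k) (bar_insert j k gs)))\<bar>"
        unfolding y(3) using K y uf_support[OF c]
        by (intro arg_cong[of _ _ abs] uf_boundary_path) auto
      also have "\<dots> \<le> (\<Sum>j\<le>Suc n. real (card K) * B)"
      proof (rule order_trans[OF sum_abs], rule sum_mono)
        fix j
        have "\<bar>\<Sum>k\<in>K. c (path (base_shift j x k) (bar_insert j k gs))\<bar> \<le> (\<Sum>k\<in>K. B)"
          by (rule order_trans[OF sum_abs], rule sum_mono) (rule B)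
        then show "\<bar>(-1) ^ j * (\<Sum>k\<in>K. c (path (base_shift j x k) (bar_insert j k gs)))\<bar>
            \<le> real (card K) * B"
          by (simp add: abs_mult)
      qed
      also have "\<dots> = real (Suc (Suc n)) * (real (card K) * B)" by (simp del: sum.atMost_Suc)
      finally show ?thesis .
    qed (use B in simp)
  next
    fix y a b assume "uf_bd (Suc n) c y \<noteq> 0" and ab: "a \<in> set y" "b \<in> set y"
    then show "len (inv a \<otimes> b) \<le> R"
    proof (elim boundary_op_nonzeroE)
      fix j x assume "c x \<noteq> 0" "delete_face j x = y"
      then show ?thesis using ab set_delete_face[of j x] by (intro R[of x]) auto
    qed
  qed (rule supp)
qed

section \<open>Cycles and boundaries of the uniformly finite complex\<close>

lemma uf_boundary_add:
  assumes "c \<in> uf n" "e \<in> uf n"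
  shows "uf_bd n (\<lambda>x. c x + e x) = (\<lambda>y. uf_bd n c y + uf_bd n e y)"
  using assms by (intro boundary_op_add finite_uf_fibre) auto

lemma function_subspace_uf_cycles: "function_subspace (cycle_space uf uf_bd n)"
  using function_subspace_uf[of n]
  by (intro function_subspaceI)
    (auto simp: cycle_space_def function_subspace_def uf_boundary_add boundary_op_scale,
     auto simp: boundary_op_def fun_eq_iff)

lemma function_subspace_uf_boundaries: "function_subspace (boundary_space uf uf_bd n)"
  (is "function_subspace ?B")
proof (rule function_subspaceI)
  note S = function_subspace_uf[of "Suc n"]
  show "(\<lambda>x. 0) \<in> ?B"
    unfolding boundary_space_def
    by (rule image_eqI[OF _ function_subspace_zero[OF S]]) (simp add: boundary_op_def fun_eq_iff)
  fix f r assume "f \<in> ?B"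
  then obtain c where c: "c \<in> uf (Suc n)" "f = uf_bd (Suc n) c"
    by (auto simp: boundary_space_def)
  show "(\<lambda>x. r * f x) \<in> ?B"
    unfolding boundary_space_def
    by (rule image_eqI[OF _ function_subspace_scale[OF S c(1)]]) (simp add: c boundary_op_scale)
  fix g assume "g \<in> ?B"
  then obtain e where e: "e \<in> uf (Suc n)" "g = uf_bd (Suc n) e"
    by (auto simp: boundary_space_def)
  show "(\<lambda>x. f x + g x) \<in> ?B"
    unfolding boundary_space_def c(2) e(2)
    by (rule image_eqI[OF _ function_subspace_add[OF S c(1) e(1)]]) (simp only: uf_boundary_add[OF c(1) e(1)])
qed

text \<open>In positive degree a double face still has a vertex, so its fibres are finite and the
  general cancellation applies; in degree 0 every chain is a cycle.\<close>

lemma uf_boundaries_subset_cycles: "boundary_space uf uf_bd n \<subseteq> cycle_space uf uf_bd n"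
proof
  fix b assume "b \<in> boundary_space uf uf_bd n"
  then obtain c where c: "c \<in> uf (Suc n)" and b: "b = uf_bd (Suc n) c" by (auto simp: boundary_space_def)
  have "uf_bd n (uf_bd (Suc n) c) y = 0" for y
  proof (cases "n = 0")
    case False
    have len: "length x = Suc (Suc n)" if "c x \<noteq> 0" for x
      using uf_support[OF c that] by (simp add: tuples_def)
    show ?thesis
    proof (rule boundary_op_boundary_op)
      fix i j assume ij: "i \<le> n" "j \<le> Suc n"
      show "finite {x. c x \<noteq> 0 \<and> delete_face i (delete_face j x) = y}"
      proof (rule finite_subset[OF _ finite_uf_support_through[OF c, of "hd y"]], rule subsetI)
        fix x assume "x \<in> {x. c x \<noteq> 0 \<and> delete_face i (delete_face j x) = y}"
        then have x: "c x \<noteq> 0" "y = delete_face i (delete_face j x)" by auto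
        then have "delete_face i (delete_face j x) \<noteq> []"
          using len[of x] ij False length_delete_face[of j x] length_delete_face[of i "delete_face j x"] by auto
        then show "x \<in> {x. c x \<noteq> 0 \<and> hd y \<in> set x}"
          using x set_delete_face[of i "delete_face j x"] set_delete_face[of j x] hd_in_set by blast
      qed
    qed (use len False in \<open>auto intro: delete_face_delete_face\<close>)
  qed (simp add: boundary_op_def)
  then show "b \<in> cycle_space uf uf_bd n"
    using uf_boundary_in_uf[OF c] by (auto simp: cycle_space_def b)
qed

end

section \<open>Invariant functionals\<close>

context group
begin

text \<open>Values off the carrier are unrestricted, in contrast to \<open>linfty\<close>, so
  translates need no truncation. \<open>invariant_functional\<close> demands in return that only
  values on the carrier count.\<close>

definition bounded_fun :: "('a \<Rightarrow> real) \<Rightarrow> bool" where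
  "bounded_fun f \<longleftrightarrow> (\<exists>B. \<forall>x\<in>carrier G. \<bar>f x\<bar> \<le> B)"

text \<open>A linear functional on \<open>\<ell>\<^sup>\<infinity>(G)\<close>, invariant under \<^emph>\<open>right\<close> translations: these
  occur in the \<open>0\<close>-th face because the word metric is left invariant.\<close>

definition invariant_functional :: "(('a \<Rightarrow> real) \<Rightarrow> real) \<Rightarrow> bool" where
  "invariant_functional \<mu> \<longleftrightarrow>
    (\<forall>f g. (\<forall>x\<in>carrier G. f x = g x) \<longrightarrow> \<mu> f = \<mu> g) \<and>
    (\<forall>f g. bounded_fun f \<longrightarrow> bounded_fun g \<longrightarrow> \<mu> (\<lambda>x. f x + g x) = \<mu> f + \<mu> g) \<and>
    (\<forall>f r. bounded_fun f \<longrightarrow> \<mu> (\<lambda>x. r * f x) = r * \<mu> f) \<and>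
    (\<forall>f g. bounded_fun f \<longrightarrow> g \<in> carrier G \<longrightarrow> \<mu> (\<lambda>x. f (x \<otimes> g)) = \<mu> f)"

section \<open>Rules for bounded functions and functionals\<close>

lemma functional_cong:
  "invariant_functional \<mu> \<Longrightarrow> (\<And>x. x \<in> carrier G \<Longrightarrow> f x = g x) \<Longrightarrow> \<mu> f = \<mu> g"
  and functional_add:
  "invariant_functional \<mu> \<Longrightarrow> bounded_fun f \<Longrightarrow> bounded_fun g \<Longrightarrow> \<mu> (\<lambda>x. f x + g x) = \<mu> f + \<mu> g"
  and functional_scale:
  "invariant_functional \<mu> \<Longrightarrow> bounded_fun f \<Longrightarrow> \<mu> (\<lambda>x. r * f x) = r * \<mu> f"
  and functional_translate:
  "invariant_functional \<mu> \<Longrightarrow> bounded_fun f \<Longrightarrow> a \<in> carrier G \<Longrightarrow> \<mu> (\<lambda>x. f (x \<otimes> a)) = \<mu> f"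
  unfolding invariant_functional_def by blast+

lemma bounded_funI: "(\<And>x. x \<in> carrier G \<Longrightarrow> \<bar>f x\<bar> \<le> B) \<Longrightarrow> bounded_fun f"
  unfolding bounded_fun_def by blast

lemma bounded_fun_const: "bounded_fun (\<lambda>x. r)"
  by (rule bounded_funI[of _ "\<bar>r\<bar>"]) simp

lemma bounded_fun_indicator: "bounded_fun (\<lambda>x. indicator A (h x))"
  by (rule bounded_funI[of _ 1]) (simp add: indicator_def)

lemma bounded_fun_scale:
  assumes "bounded_fun f"
  shows "bounded_fun (\<lambda>x. r * f x)"
proof -
  obtain B where "\<And>x. x \<in> carrier G \<Longrightarrow> \<bar>f x\<bar> \<le> B" using assms by (auto simp: bounded_fun_def)
  then show ?thesis by (intro bounded_funI[of _ "\<bar>r\<bar> * B"]) (simp add: abs_mult mult_left_mono)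
qed

lemma bounded_fun_add:
  assumes "bounded_fun f" "bounded_fun g"
  shows "bounded_fun (\<lambda>x. f x + g x)"
proof -
  obtain B C where "\<And>x. x \<in> carrier G \<Longrightarrow> \<bar>f x\<bar> \<le> B" "\<And>x. x \<in> carrier G \<Longrightarrow> \<bar>g x\<bar> \<le> C"
    using assms by (auto simp: bounded_fun_def)
  then show ?thesis
    by (intro bounded_funI[of _ "B + C"]) (meson abs_triangle_ineq add_mono order_trans)
qed

lemma bounded_fun_sum:
  "(\<And>j. j \<in> J \<Longrightarrow> bounded_fun (f j)) \<Longrightarrow> bounded_fun (\<lambda>x. \<Sum>j\<in>J. f j x)"
  by (induction J rule: infinite_finite_induct) (simp_all add: bounded_fun_const bounded_fun_add)

lemma bounded_fun_comp:
  assumes "bounded_fun f" "\<And>x. x \<in> carrier G \<Longrightarrow> h x \<in> carrier G"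
  shows "bounded_fun (\<lambda>x. f (h x))"
  using assms unfolding bounded_fun_def by blast

lemma functional_zero: "invariant_functional \<mu> \<Longrightarrow> \<mu> (\<lambda>x. 0) = 0"
  using functional_scale[of \<mu> "\<lambda>x. 0" 0] bounded_fun_const[of 0] by simp

lemma functional_sum:
  assumes "invariant_functional \<mu>" "\<And>j. j \<in> J \<Longrightarrow> bounded_fun (f j)"
  shows "\<mu> (\<lambda>x. \<Sum>j\<in>J. f j x) = (\<Sum>j\<in>J. \<mu> (f j))"
  using assms(2)
proof (induction J rule: infinite_finite_induct)
  case (insert j J)
  then have "\<mu> (\<lambda>x. f j x + (\<Sum>j\<in>J. f j x)) = \<mu> (f j) + \<mu> (\<lambda>x. \<Sum>j\<in>J. f j x)"
    by (intro functional_add[OF assms(1)] bounded_fun_sum) auto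
  then show ?case using insert by simp
qed (simp_all add: functional_zero[OF assms(1)])

section \<open>Invariant means\<close>

definition right_invariant_mean :: "(('a \<Rightarrow> real) \<Rightarrow> real) \<Rightarrow> bool" where
  "right_invariant_mean \<mu> \<longleftrightarrow> invariant_functional \<mu> \<and> \<mu> (\<lambda>x. 1) = 1 \<and>
     (\<forall>f. bounded_fun f \<longrightarrow> (\<forall>x\<in>carrier G. f x \<ge> 0) \<longrightarrow> \<mu> f \<ge> 0)"

text \<open>Inversion on \<open>G\<close> exchanges left and right translations; \<open>T\<close>
  composes with it and extends by zero as \<open>linfty\<close> requires.\<close>

lemma amenable_imp_right_invariant_mean:
  assumes "amenable G"
  obtains \<mu> where "right_invariant_mean \<mu>"
proof -
  obtain m where m: "left_invariant_mean G m" using assms by (auto simp: amenable_def)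
  define T where "T f = (\<lambda>x. if x \<in> carrier G then f (inv x) else (0::real))" for f
  have T: "T f \<in> linfty G" if "bounded_fun f" for f
    using that unfolding linfty_def T_def bounded_fun_def by auto
  have "right_invariant_mean (\<lambda>f. m (T f))"
    unfolding right_invariant_mean_def invariant_functional_def
  proof (intro conjI allI impI)
    fix f g :: "'a \<Rightarrow> real" assume "\<forall>x\<in>carrier G. f x = g x"
    then have "T f = T g" by (auto simp: T_def)
    then show "m (T f) = m (T g)" by simp
  next
    fix f g :: "'a \<Rightarrow> real" assume fg: "bounded_fun f" "bounded_fun g"
    have "T (\<lambda>x. f x + g x) = (\<lambda>x. T f x + T g x)" by (auto simp: T_def)
    then show "m (T (\<lambda>x. f x + g x)) = m (T f) + m (T g)"
      using m T[OF fg(1)] T[OF fg(2)] by (simp add: left_invariant_mean_def)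
  next
    fix f :: "'a \<Rightarrow> real" and r assume f: "bounded_fun f"
    have "T (\<lambda>x. r * f x) = (\<lambda>x. r * T f x)" by (auto simp: T_def)
    then show "m (T (\<lambda>x. r * f x)) = r * m (T f)"
      using m T[OF f] by (simp add: left_invariant_mean_def)
  next
    fix f :: "'a \<Rightarrow> real" and g assume f: "bounded_fun f" and g: "g \<in> carrier G"
    have "T (\<lambda>x. f (x \<otimes> g)) = left_translate G g (T f)"
      using g by (auto simp: T_def left_translate_def inv_mult_group)
    then show "m (T (\<lambda>x. f (x \<otimes> g))) = m (T f)"
      using m T[OF f] g by (simp add: left_invariant_mean_def)
  next
    show "m (T (\<lambda>x. 1)) = 1" using m by (simp add: left_invariant_mean_def T_def)
  next
    fix f :: "'a \<Rightarrow> real" assume f: "bounded_fun f" "\<forall>x\<in>carrier G. f x \<ge> 0"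
    then show "m (T f) \<ge> 0" using m T[OF f(1)] by (simp add: left_invariant_mean_def T_def)
  qed
  then show thesis by (rule that)
qed

context
  fixes \<mu>
  assumes \<mu>: "right_invariant_mean \<mu>"
begin

lemma mean_functional: "invariant_functional \<mu>"
  using \<mu> by (simp add: right_invariant_mean_def)

lemma mean_const: "\<mu> (\<lambda>x. r) = r"
  using functional_scale[OF mean_functional bounded_fun_const, of r 1] \<mu>
  by (simp add: right_invariant_mean_def)

lemma mean_mono:
  assumes "bounded_fun f" "bounded_fun g" "\<And>x. x \<in> carrier G \<Longrightarrow> f x \<le> g x"
  shows "\<mu> f \<le> \<mu> g"
proof -
  have f': "bounded_fun (\<lambda>x. -1 * f x)" by (rule bounded_fun_scale[OF assms(1)])
  have "0 \<le> \<mu> (\<lambda>x. g x + -1 * f x)"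
    using \<mu> bounded_fun_add[OF assms(2) f'] assms(3) by (simp add: right_invariant_mean_def)
  also have "\<dots> = \<mu> g + -1 * \<mu> f"
    using functional_add[OF mean_functional assms(2) f'] functional_scale[OF mean_functional assms(1), of "-1"]
    by simp
  finally show ?thesis by simp
qed

lemma mean_abs_le:
  assumes "\<And>x. x \<in> carrier G \<Longrightarrow> \<bar>f x\<bar> \<le> B"
  shows "\<bar>\<mu> f\<bar> \<le> B"
proof -
  have f: "bounded_fun f" using assms by (rule bounded_funI)
  have "\<mu> (\<lambda>x. - B) \<le> \<mu> f" "\<mu> f \<le> \<mu> (\<lambda>x. B)"
    using assms by (auto intro!: mean_mono f bounded_fun_const simp: abs_le_iff minus_le_iff)
  then show ?thesis by (simp add: mean_const)
qed

text \<open>The translates \<open>q H r\<close> of \<open>q H\<close> all have the same mean by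
  right invariance. Any \<open>N\<close> distinct ones are disjoint, so \<open>N\<close> times this
  mean is at most 1.\<close>

lemma mean_coset_infinite_index:
  assumes H: "subgroup H G" and inf: "infinite (rcosets H)" and q: "q \<in> carrier G"
  shows "\<mu> (\<lambda>x. indicator H (inv q \<otimes> x)) = 0"
proof -
  let ?f = "\<lambda>C x. indicator C (inv q \<otimes> x) :: real"
  have same: "\<mu> (?f C) = \<mu> (?f H)" if C: "C \<in> rcosets H" for C
  proof -
    obtain r where r: "r \<in> carrier G" "C = H #> r" using C by (auto simp: RCOSETS_def)
    have "\<mu> (?f C) = \<mu> (\<lambda>x. ?f H (x \<otimes> inv r))"
    proof (rule functional_cong[OF mean_functional])
      fix x assume x: "x \<in> carrier G"
      have "inv q \<otimes> x \<in> C \<longleftrightarrow> inv q \<otimes> x \<otimes> inv r \<in> H"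
        unfolding r(2) using r(1) x q by (intro subgroup.rcos_module[OF H is_group]) auto
      then show "?f C x = ?f H (x \<otimes> inv r)" using x q r by (simp add: indicator_def m_assoc)
    qed
    also have "\<dots> = \<mu> (?f H)"
      using r by (intro functional_translate[OF mean_functional]) (auto simp: bounded_fun_indicator)
    finally show ?thesis .
  qed
  have "real N * \<mu> (?f H) \<le> 1" for N
  proof -
    obtain T where T: "T \<subseteq> rcosets H" "finite T" "card T = N"
      using infinite_arbitrarily_large[OF inf] by metis
    have "(\<Sum>C\<in>T. ?f C x) \<le> 1" for x
    proof (cases "\<exists>C\<in>T. inv q \<otimes> x \<in> C")
      case True
      then obtain C where C: "C \<in> T" "inv q \<otimes> x \<in> C" by blast
      have "inv q \<otimes> x \<notin> D" if "D \<in> T" "D \<noteq> C" for D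
        using rcos_disjoint[OF H] that C T(1) by (auto simp: pairwise_def disjnt_iff)
      then have "(\<Sum>D\<in>T. ?f D x) = (\<Sum>D\<in>{C}. ?f D x)"
        using T C by (intro sum.mono_neutral_right) (auto simp: indicator_def)
      then show ?thesis by (simp add: C(2))
    qed (simp add: indicator_def)
    then have "\<mu> (\<lambda>x. \<Sum>C\<in>T. ?f C x) \<le> \<mu> (\<lambda>x. 1)"
      by (intro mean_mono bounded_fun_sum bounded_fun_indicator bounded_fun_const)
    moreover have "\<mu> (\<lambda>x. \<Sum>C\<in>T. ?f C x) = (\<Sum>C\<in>T. \<mu> (?f C))"
      by (intro functional_sum mean_functional bounded_fun_indicator)
    moreover have "\<dots> = real N * \<mu> (?f H)" using same T by (simp add: subset_iff)
    ultimately show ?thesis by (simp add: mean_const)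
  qed
  moreover have "\<mu> (?f H) \<ge> 0"
    using \<mu> bounded_fun_indicator[of H "\<lambda>x. inv q \<otimes> x"] indicator_pos_le
    unfolding right_invariant_mean_def by blast
  ultimately show ?thesis
    using reals_Archimedean3[of "\<mu> (?f H)"] by (metis less_eq_real_def not_less)
qed

text \<open>A case of B. H. Neumann's lemma that a group is not a finite union of cosets of infinite
  index subgroups; here it is immediate, since such cosets have mean zero.\<close>

lemma exists_avoiding_translate:
  assumes H: "subgroup H G" and inf: "infinite (rcosets H)"
    and D: "finite D" "D \<subseteq> carrier G \<times> carrier G"
  obtains x where "x \<in> carrier G" "\<And>p q. (p, q) \<in> D \<Longrightarrow> inv q \<otimes> (x \<otimes> p) \<notin> H"
proof -
  let ?f = "\<lambda>(p, q) x. indicator H (inv q \<otimes> (x \<otimes> p)) :: real"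
  have "\<exists>x\<in>carrier G. \<forall>(p, q)\<in>D. inv q \<otimes> (x \<otimes> p) \<notin> H"
  proof (rule ccontr)
    assume "\<not> ?thesis"
    then have cover: "\<exists>d\<in>D. ?f d x = 1" if "x \<in> carrier G" for x
      using that by (fastforce simp: indicator_def)
    have bdd: "bounded_fun (?f d)" for d
      by (cases d) (simp add: bounded_fun_indicator)
    have "\<mu> (\<lambda>x. 1) \<le> \<mu> (\<lambda>x. \<Sum>d\<in>D. ?f d x)"
    proof (intro mean_mono bounded_fun_const bounded_fun_sum bdd)
      fix x assume "x \<in> carrier G"
      then obtain d where "d \<in> D" "?f d x = 1" using cover by blast
      moreover have "?f e x \<ge> 0" for e by (cases e) (simp add: indicator_def)
      ultimately show "1 \<le> (\<Sum>d\<in>D. ?f d x)"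
        using member_le_sum[of d D "\<lambda>d. ?f d x"] D(1) by simp
    qed
    also have "\<dots> = (\<Sum>d\<in>D. \<mu> (?f d))"
      by (intro functional_sum mean_functional bdd)
    also have "\<dots> = (\<Sum>d\<in>D. 0)"
    proof (intro sum.cong refl)
      fix d assume "d \<in> D"
      then obtain p q where d: "d = (p, q)" "p \<in> carrier G" "q \<in> carrier G" using D(2) by auto
      \<comment> \<open>The condition on \<open>x\<close> describes the set
        \<open>q H p\<inverse>\<close>; translating by \<open>p\<close> reduces it to
        \<open>q H\<close>.\<close>
      have "\<mu> (?f d) = \<mu> (\<lambda>x. indicator H (inv q \<otimes> x))"
        using functional_translate[OF mean_functional bounded_fun_indicator[of H "\<lambda>x. inv q \<otimes> x"] d(2)]
        by (simp add: d(1))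
      then show "\<mu> (?f d) = 0" using mean_coset_infinite_index[OF H inf d(3)] by simp
    qed
    finally show False by (simp add: mean_const)
  qed
  then show thesis using that by blast
qed

text \<open>Points are cosets of the trivial subgroup, which has infinite index, so finitely many
  values do not affect the mean. It can thus act as a generalised limit along an enumeration of
  \<open>G\<close>.\<close>

lemma mean_cofinite_const:
  assumes inf: "infinite (carrier G)" and f: "bounded_fun f" and fin: "finite {x \<in> carrier G. f x \<noteq> r}"
  shows "\<mu> f = r"
proof -
  let ?F = "{x \<in> carrier G. f x \<noteq> r}"
  have triv: "subgroup {\<one>} G" by (rule triv_subgroup)
  have "rcosets {\<one>} = (\<lambda>x. {x}) ` carrier G" by (auto simp: RCOSETS_def r_coset_def)
  then have "infinite (rcosets {\<one>})" using inf by (simp add: finite_image_iff)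
  note null = mean_coset_infinite_index[OF triv this]
  \<comment> \<open>\<open>?s p\<close> is the point mass at \<open>p\<close> that corrects the
    constant \<open>r\<close> to \<open>f p\<close>.\<close>
  let ?s = "\<lambda>p x. (f p - r) * indicator {\<one>} (inv p \<otimes> x) :: real"
  have "\<mu> f = \<mu> (\<lambda>x. r + (\<Sum>p\<in>?F. ?s p x))"
  proof (rule functional_cong[OF mean_functional])
    fix x assume x: "x \<in> carrier G"
    have "(\<Sum>p\<in>?F. ?s p x) = (\<Sum>p\<in>?F. if p = x then f x - r else 0)"
      using x by (intro sum.cong) (auto simp: indicator_def inv_equality m_assoc dest: inv_equality)
    also have "\<dots> = f x - r" using fin x by simp
    finally show "f x = r + (\<Sum>p\<in>?F. ?s p x)" by simp
  qed
  also have "\<dots> = \<mu> (\<lambda>x. r) + \<mu> (\<lambda>x. \<Sum>p\<in>?F. ?s p x)"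
    by (intro functional_add mean_functional bounded_fun_const bounded_fun_sum bounded_fun_scale
        bounded_fun_indicator)
  also have "\<mu> (\<lambda>x. \<Sum>p\<in>?F. ?s p x) = (\<Sum>p\<in>?F. \<mu> (?s p))"
    by (intro functional_sum mean_functional bounded_fun_scale bounded_fun_indicator)
  also have "\<dots> = 0"
    by (intro sum.neutral) (simp add: functional_scale[OF mean_functional bounded_fun_indicator] null)
  finally show ?thesis by (simp add: mean_const)
qed

text \<open>The mean serves three times: it yields the points \<open>x n\<close>, it is the limit
  along a family of blocks, and it averages over \<open>g\<close>. Countability supplies the
  exhaustion \<open>F\<close> and the indices \<open>\<nu>\<close>.\<close>

lemma dual_functionals:
  assumes H: "subgroup H G" and inf: "infinite (rcosets H)" and count: "countable (carrier G)"
  shows "\<exists>(m :: nat \<Rightarrow> ('a \<Rightarrow> real) \<Rightarrow> real) \<phi>.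
    (\<forall>i. invariant_functional (m i)) \<and> (\<forall>j. bounded_fun (\<phi> j)) \<and>
    (\<forall>j. \<forall>x\<in>carrier G. \<forall>h\<in>H. \<phi> j (x \<otimes> h) = \<phi> j x) \<and>
    (\<forall>i j. m i (\<phi> j) = (if i = j then 1 else 0))"
proof -
  have HG: "H \<subseteq> carrier G" using H by (rule subgroup.subset)
  define \<nu> where "\<nu> = to_nat_on (carrier G)"
  define F where "F n = {p \<in> carrier G. \<nu> p \<le> n}" for n
  have finF: "finite (F n)" for n
  proof (rule inj_on_finite[of \<nu> _ "{..n}"])
    show "inj_on \<nu> (F n)"
      using inj_on_to_nat_on[OF count] by (auto simp: \<nu>_def F_def inj_on_def)
  qed (auto simp: F_def)
  have infG: "infinite (carrier G)"
  proof
    assume "finite (carrier G)"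
    then have "finite (rcosets H)" by (simp add: RCOSETS_def)
    with inf show False by simp
  qed
  have "\<exists>x. \<forall>n. x n \<in> carrier G \<and>
      (\<forall>m<n. \<forall>p\<in>F n. \<forall>q\<in>F m. inv (x m \<otimes> q) \<otimes> (x n \<otimes> p) \<notin> H)"
  proof (rule dependent_wellorder_choice)
    fix x :: "nat \<Rightarrow> 'a" and n
    assume x: "\<And>m. m < n \<Longrightarrow> x m \<in> carrier G \<and>
      (\<forall>l<m. \<forall>p\<in>F m. \<forall>q\<in>F l. inv (x l \<otimes> q) \<otimes> (x m \<otimes> p) \<notin> H)"
    \<comment> \<open>The new point has to avoid the finitely many earlier blocks; each possible
      meeting is recorded as a pair.\<close>
    let ?D = "\<Union>m<n. F n \<times> (\<lambda>q. x m \<otimes> q) ` F m"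
    have D: "finite ?D" "?D \<subseteq> carrier G \<times> carrier G"
      using finF x by (auto simp: F_def)
    obtain r where "r \<in> carrier G" "\<And>p q. (p, q) \<in> ?D \<Longrightarrow> inv q \<otimes> (r \<otimes> p) \<notin> H"
      by (rule exists_avoiding_translate[OF H inf D]) blast
    then show "\<exists>r. r \<in> carrier G \<and> (\<forall>m<n. \<forall>p\<in>F n. \<forall>q\<in>F m. inv (x m \<otimes> q) \<otimes> (r \<otimes> p) \<notin> H)"
      by (intro exI[of _ r]) blast
  qed auto
  then obtain x where x: "\<And>n. x n \<in> carrier G"
    and less: "\<And>m n p q. m < n \<Longrightarrow> p \<in> F n \<Longrightarrow> q \<in> F m \<Longrightarrow> inv (x m \<otimes> q) \<otimes> (x n \<otimes> p) \<notin> H"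
    by blast
  have neq: "inv (x m \<otimes> q) \<otimes> (x n \<otimes> p) \<notin> H" if "m \<noteq> n" "p \<in> F n" "q \<in> F m" for m n p q
  proof (cases "m < n")
    case False
    have c: "x m \<otimes> q \<in> carrier G" "x n \<otimes> p \<in> carrier G" using x that by (auto simp: F_def)
    have "inv (inv (x m \<otimes> q) \<otimes> (x n \<otimes> p)) = inv (x n \<otimes> p) \<otimes> (x m \<otimes> q)"
      using c by (simp add: inv_mult_group)
    moreover have "inv (x n \<otimes> p) \<otimes> (x m \<otimes> q) \<notin> H" using False that less[of n m q p] by simp
    ultimately show ?thesis using subgroup.m_inv_closed[OF H] by metis
  qed (use less that in blast)
  \<comment> \<open>\<open>prod_encode\<close> splits the indices into infinitely many infinite
    families. The block at \<open>X k j\<close> uses \<open>F (prod_encode (k, j))\<close>, which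
    contains \<open>F k\<close>.\<close>
  define X where "X k j = x (prod_encode (k, j))" for k j
  define \<phi> :: "nat \<Rightarrow> 'a \<Rightarrow> real" where
    "\<phi> j = indicator {a. \<exists>k. \<exists>p\<in>F (prod_encode (k, j)). inv (X k j \<otimes> p) \<otimes> a \<in> H}" for j
  \<comment> \<open>The inner mean is a limit over the index \<open>\<nu> y\<close> within the
    \<open>j\<close>-th family; the outer one makes the result right invariant in
    \<open>f\<close>.\<close>
  define m where "m j f = \<mu> (\<lambda>g. \<mu> (\<lambda>y. f (X (\<nu> y) j \<otimes> g)))" for j and f :: "'a \<Rightarrow> real"
  have X: "X k j \<in> carrier G" for k j using x by (simp add: X_def)
  have \<phi>_bdd: "bounded_fun (\<phi> j)" for j
    unfolding \<phi>_def using bounded_fun_indicator[of _ "\<lambda>x. x"] by simp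
  have inner_bdd: "bounded_fun (\<lambda>y. f (X (\<nu> y) j \<otimes> g))" if "bounded_fun f" "g \<in> carrier G" for f j g
    using bounded_fun_comp[OF that(1), of "\<lambda>y. X (\<nu> y) j \<otimes> g"] X that(2) by simp
  have outer_bdd: "bounded_fun (\<lambda>g. \<mu> (\<lambda>y. f (X (\<nu> y) j \<otimes> g)))" if f: "bounded_fun f" for f j
  proof -
    obtain B where B: "\<And>x. x \<in> carrier G \<Longrightarrow> \<bar>f x\<bar> \<le> B" using f by (auto simp: bounded_fun_def)
    show ?thesis
      by (rule bounded_funI[of _ B], rule mean_abs_le) (simp add: B X)
  qed
  note cong = functional_cong[OF mean_functional]
  have inv: "invariant_functional (m j)" for j
    unfolding invariant_functional_def
  proof (intro conjI allI impI)
    fix f g :: "'a \<Rightarrow> real" assume "\<forall>x\<in>carrier G. f x = g x"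
    then show "m j f = m j g" unfolding m_def by (intro cong) (simp add: X)
  next
    fix f g :: "'a \<Rightarrow> real" assume fg: "bounded_fun f" "bounded_fun g"
    have "m j (\<lambda>x. f x + g x)
        = \<mu> (\<lambda>x. \<mu> (\<lambda>y. f (X (\<nu> y) j \<otimes> x)) + \<mu> (\<lambda>y. g (X (\<nu> y) j \<otimes> x)))"
      unfolding m_def by (rule cong) (simp add: functional_add[OF mean_functional] inner_bdd fg)
    then show "m j (\<lambda>x. f x + g x) = m j f + m j g"
      unfolding m_def by (simp add: functional_add[OF mean_functional] outer_bdd fg)
  next
    fix f :: "'a \<Rightarrow> real" and r assume f: "bounded_fun f"
    have "m j (\<lambda>x. r * f x) = \<mu> (\<lambda>x. r * \<mu> (\<lambda>y. f (X (\<nu> y) j \<otimes> x)))"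
      unfolding m_def by (rule cong) (simp add: functional_scale[OF mean_functional] inner_bdd f)
    then show "m j (\<lambda>x. r * f x) = r * m j f"
      unfolding m_def by (simp add: functional_scale[OF mean_functional] outer_bdd f)
  next
    fix f :: "'a \<Rightarrow> real" and g assume f: "bounded_fun f" and g: "g \<in> carrier G"
    have "m j (\<lambda>x. f (x \<otimes> g)) = \<mu> (\<lambda>x. \<mu> (\<lambda>y. f (X (\<nu> y) j \<otimes> (x \<otimes> g))))"
      unfolding m_def by (rule cong, rule cong) (simp add: X g m_assoc)
    also have "\<dots> = m j f"
      unfolding m_def by (rule functional_translate[OF mean_functional outer_bdd[OF f] g])
    finally show "m j (\<lambda>x. f (x \<otimes> g)) = m j f" .
  qed
  have \<phi>_X: "\<phi> i (X k j \<otimes> g) = (if i = j then 1 else 0)" if g: "g \<in> carrier G" "\<nu> g \<le> k" for i j k g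
  proof -
    have gF: "g \<in> F (prod_encode (k, j))"
      using g le_prod_encode_1[of k j] by (simp add: F_def)
    show ?thesis
    proof (cases "i = j")
      case True
      have "inv (X k j \<otimes> g) \<otimes> (X k j \<otimes> g) \<in> H"
        using X g subgroup.one_closed[OF H] by simp
      then show ?thesis using True gF by (auto simp: \<phi>_def indicator_def)
    next
      case False
      have "inv (X l i \<otimes> p) \<otimes> (X k j \<otimes> g) \<notin> H" if "p \<in> F (prod_encode (l, i))" for l p
        unfolding X_def using False gF that by (intro neq) auto
      then show ?thesis using False by (auto simp: \<phi>_def indicator_def)
    qed
  qed
  have "m i (\<phi> j) = (if i = j then 1 else 0)" for i j
  proof -
    have "m i (\<phi> j) = \<mu> (\<lambda>g. if j = i then 1 else 0)"
      unfolding m_def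
    proof (rule cong)
      fix g assume g: "g \<in> carrier G"
      show "\<mu> (\<lambda>y. \<phi> j (X (\<nu> y) i \<otimes> g)) = (if j = i then 1 else 0)"
      proof (rule mean_cofinite_const[OF infG inner_bdd[OF \<phi>_bdd g]])
        \<comment> \<open>\<open>\<phi>_X\<close> fixes the value as soon as
          \<open>\<nu> g \<le> \<nu> y\<close>, so exceptions have smaller index than
          \<open>g\<close>.\<close>
        have "{y \<in> carrier G. \<phi> j (X (\<nu> y) i \<otimes> g) \<noteq> (if j = i then 1 else 0)} \<subseteq> F (\<nu> g)"
          using \<phi>_X[OF g] by (auto simp: F_def) (metis nle_le)+
        then show "finite {y \<in> carrier G. \<phi> j (X (\<nu> y) i \<otimes> g) \<noteq> (if j = i then 1 else 0)}"
          using finF finite_subset by blast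
      qed
    qed
    then show ?thesis by (auto simp: mean_const)
  qed
  moreover have "\<phi> j (a \<otimes> h) = \<phi> j a" if a: "a \<in> carrier G" and h: "h \<in> H" for j a h
  proof -
    have "inv (X k j \<otimes> p) \<otimes> (a \<otimes> h) \<in> H \<longleftrightarrow> inv (X k j \<otimes> p) \<otimes> a \<in> H"
      if "p \<in> F (prod_encode (k, j))" for k p
    proof -
      have c: "inv (X k j \<otimes> p) \<in> carrier G" "h \<in> carrier G" using that X h HG by (auto simp: F_def)
      have e: "inv (X k j \<otimes> p) \<otimes> (a \<otimes> h) = inv (X k j \<otimes> p) \<otimes> a \<otimes> h"
        using c a by (simp add: m_assoc)
      moreover have "inv (X k j \<otimes> p) \<otimes> a = inv (X k j \<otimes> p) \<otimes> a \<otimes> h \<otimes> inv h"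
        using c a by (simp add: m_assoc)
      ultimately show ?thesis
        using subgroup.m_closed[OF H] subgroup.m_inv_closed[OF H] h by metis
    qed
    then show ?thesis by (auto simp: \<phi>_def indicator_def)
  qed
  ultimately show ?thesis using inv \<phi>_bdd by (intro exI[of _ m] exI[of _ \<phi>]) simp
qed

end

end

section \<open>Comparison of uniformly finite and bar chains\<close>

context proper_length_group
begin

definition integrate :: "(('a \<Rightarrow> real) \<Rightarrow> real) \<Rightarrow> nat \<Rightarrow> ('a list \<Rightarrow> real) \<Rightarrow> 'a list \<Rightarrow> real" where
  "integrate \<mu> n c gs = (if gs \<in> tuples (carrier G) n then \<mu> (\<lambda>x. c (path x gs)) else 0)"

text \<open>The chain \<open>\<phi> \<cdot> z\<close>: its value at \<open>path x gs\<close> is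
  \<open>\<phi> x * z gs\<close>.\<close>

definition spread :: "('a \<Rightarrow> real) \<Rightarrow> nat \<Rightarrow> ('a list \<Rightarrow> real) \<Rightarrow> 'a list \<Rightarrow> real" where
  "spread \<phi> n z X = (if X \<in> tuples (carrier G) (Suc n) then \<phi> (hd X) * z (increments X) else 0)"

section \<open>From uniformly finite chains to bar chains\<close>

lemma bounded_fun_uf:
  assumes "c \<in> uf n"
  shows "bounded_fun (\<lambda>x. c (h x))"
proof -
  obtain B where "\<And>x. \<bar>c x\<bar> \<le> B" using uf_boundedE[OF assms] by metis
  then show ?thesis by (intro bounded_funI)
qed

lemma integrate_support:
  assumes \<mu>: "invariant_functional \<mu>"
    and K: "\<And>X. c X \<noteq> 0 \<Longrightarrow> set (increments X) \<subseteq> K"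
    and nz: "integrate \<mu> n c gs \<noteq> 0"
  shows "gs \<in> tuples (carrier G) n" "set gs \<subseteq> K"
proof -
  show gs: "gs \<in> tuples (carrier G) n" using nz by (auto simp: integrate_def split: if_splits)
  have "\<exists>x\<in>carrier G. c (path x gs) \<noteq> 0"
  proof (rule ccontr)
    assume "\<not> ?thesis"
    then have "\<mu> (\<lambda>x. c (path x gs)) = \<mu> (\<lambda>x. 0)" by (intro functional_cong[OF \<mu>]) auto
    then show False using nz gs functional_zero[OF \<mu>] by (simp add: integrate_def)
  qed
  then obtain x where "x \<in> carrier G" "c (path x gs) \<noteq> 0" by blast
  then show "set gs \<subseteq> K" using K[of "path x gs"] increments_path[of x gs] gs by (auto simp: tuples_def)
qed

lemma integrate_in_bar_chains:
  assumes \<mu>: "invariant_functional \<mu>" and c: "c \<in> uf n"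
  shows "integrate \<mu> n c \<in> bar_chains G n"
proof -
  obtain K where K: "finite K" "\<And>X. c X \<noteq> 0 \<Longrightarrow> set (increments X) \<subseteq> K"
    using uf_incrementsE[OF c] by metis
  have "{gs. integrate \<mu> n c gs \<noteq> 0} \<subseteq> {gs. set gs \<subseteq> K \<and> length gs = n}"
    using integrate_support[where c = c and K = K and n = n, OF \<mu>] K(2)
    by (auto simp: tuples_def)
  then have "finite {gs. integrate \<mu> n c gs \<noteq> 0}"
    using finite_lists_length_eq[OF K(1)] finite_subset by blast
  then show ?thesis by (auto simp: bar_chains_def integrate_def)
qed

text \<open>The two boundary formulas agree insertion by insertion, up to the base point shift by
  \<open>inv k\<close> in the 0-th face, which right invariance absorbs.\<close>

lemma integrate_boundary:
  assumes \<mu>: "invariant_functional \<mu>" and c: "c \<in> uf (Suc n)"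
  shows "integrate \<mu> n (uf_bd (Suc n) c) = boundary_op (bar_face G) (Suc n) (integrate \<mu> (Suc n) c)"
proof
  fix gs
  obtain K where K: "finite K" "K \<subseteq> carrier G" "\<And>X. c X \<noteq> 0 \<Longrightarrow> set (increments X) \<subseteq> K"
    using uf_incrementsE[OF c] by metis
  show "integrate \<mu> n (uf_bd (Suc n) c) gs = boundary_op (bar_face G) (Suc n) (integrate \<mu> (Suc n) c) gs"
  proof (cases "gs \<in> tuples (carrier G) n")
    case False
    then show ?thesis
      using bar_boundary_support[OF integrate_in_bar_chains[OF \<mu> c]] by (auto simp: integrate_def)
  next
    case gs: True
    let ?c = "\<lambda>j k x. c (path (base_shift j x k) (bar_insert j k gs))"
    have bdd: "bounded_fun (?c j k)" for j k using bounded_fun_uf[OF c] by simp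
    have "uf_bd (Suc n) c (path x gs) = (\<Sum>j\<le>Suc n. (-1) ^ j * (\<Sum>k\<in>K. ?c j k x))"
      if "x \<in> carrier G" for x
      using K uf_support[OF c] that gs by (intro uf_boundary_path) auto
    then have "integrate \<mu> n (uf_bd (Suc n) c) gs = \<mu> (\<lambda>x. \<Sum>j\<le>Suc n. (-1) ^ j * (\<Sum>k\<in>K. ?c j k x))"
      unfolding integrate_def using gs by (simp only: if_True) (intro functional_cong[OF \<mu>])
    also have "\<dots> = (\<Sum>j\<le>Suc n. \<mu> (\<lambda>x. (-1) ^ j * (\<Sum>k\<in>K. ?c j k x)))"
      by (intro functional_sum \<mu> bounded_fun_scale bounded_fun_sum bdd)
    also have "\<dots> = (\<Sum>j\<le>Suc n. (-1) ^ j * (\<Sum>k\<in>K. \<mu> (?c j k)))"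
      by (intro sum.cong refl)
        (simp add: functional_scale[OF \<mu>] functional_sum[OF \<mu>] bounded_fun_sum bdd)
    also have "\<dots> = (\<Sum>j\<le>Suc n. (-1) ^ j * (\<Sum>k\<in>K. integrate \<mu> (Suc n) c (bar_insert j k gs)))"
    proof (intro sum.cong refl arg_cong2[of _ _ _ _ "(*)"])
      fix j k assume j: "j \<in> {..Suc n}" and k: "k \<in> K"
      have "\<mu> (?c j k) = \<mu> (\<lambda>x. c (path x (bar_insert j k gs)))"
        using functional_translate[OF \<mu> bounded_fun_uf[OF c], of "inv k" "\<lambda>x. path x (bar_insert j k gs)"] k K(2)
        by (cases "j = 0") (auto simp: base_shift_def)
      then show "\<mu> (?c j k) = integrate \<mu> (Suc n) c (bar_insert j k gs)"
        using bar_insert_in_tuples[of k gs n j] gs j k K(2) by (auto simp: integrate_def)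
    qed
    also have "\<dots> = boundary_op (bar_face G) (Suc n) (integrate \<mu> (Suc n) c) gs"
    proof (rule bar_boundary_eq[symmetric])
      fix X assume "integrate \<mu> (Suc n) c X \<noteq> 0"
      then show "X \<in> tuples (carrier G) (Suc n) \<and> set X \<subseteq> K"
        using integrate_support[where c = c and K = K, OF \<mu>] K(3) by blast
    qed (use K gs in auto)
    finally show ?thesis .
  qed
qed

section \<open>From bar cycles to uniformly finite cycles\<close>

lemma path_translate:
  assumes "x \<in> carrier G" "y \<in> carrier G" "set gs \<subseteq> carrier G"
  shows "path (x \<otimes> y) gs = map (\<lambda>a. x \<otimes> a) (path y gs)"
  using assms by (induction gs arbitrary: y) (auto simp: m_assoc)

text \<open>By left invariance \<open>path x gs\<close> has the same pairwise distances as
  \<open>path \<one> gs\<close>, and only the finitely many \<open>gs\<close> in the support of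
  \<open>z\<close> occur.\<close>

lemma spread_in_uf:
  assumes \<phi>: "bounded_fun \<phi>" and z: "z \<in> bar_chains G n"
  shows "spread \<phi> n z \<in> uf n"
proof -
  obtain B where B: "\<And>x. x \<in> carrier G \<Longrightarrow> \<bar>\<phi> x\<bar> \<le> B" using \<phi> by (auto simp: bounded_fun_def)
  have B0: "B \<ge> 0" using B[OF one_closed] by linarith
  let ?S = "{gs. z gs \<noteq> 0}"
  have S: "finite ?S" using z by (simp add: bar_chains_def)
  let ?C = "\<Sum>gs\<in>?S. \<bar>z gs\<bar>"
  have C: "\<bar>z gs\<bar> \<le> ?C" for gs
    using S member_le_sum[of gs ?S "\<lambda>gs. \<bar>z gs\<bar>"] by (cases "z gs = 0") (auto simp: sum_nonneg)
  let ?L = "\<Union>gs\<in>?S. (\<lambda>(a, b). len (inv a \<otimes> b)) ` (set (path \<one> gs) \<times> set (path \<one> gs))"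
  have L: "finite ?L" using S by auto
  show ?thesis
    unfolding uf_chains_iff
  proof (intro conjI exI allI impI ballI)
    fix X show "\<bar>spread \<phi> n z X\<bar> \<le> B * ?C"
    proof (cases "X \<in> tuples (carrier G) (Suc n)")
      case True
      then have "hd X \<in> carrier G" by (cases X) (auto simp: tuples_def)
      then show ?thesis using True B C B0 by (auto simp: spread_def abs_mult intro!: mult_mono)
    next
      case False
      then show ?thesis using B0 by (auto simp: spread_def sum_nonneg)
    qed
  next
    fix X a b assume nz: "spread \<phi> n z X \<noteq> 0" and ab: "a \<in> set X" "b \<in> set X"
    then have "X \<in> tuples (carrier G) (Suc n)" by (auto simp: spread_def split: if_splits)
    then obtain x gs where x: "x \<in> carrier G" "gs \<in> tuples (carrier G) n" "X = path x gs"
      by (rule tuple_is_path)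
    then have gs: "set gs \<subseteq> carrier G" by (simp add: tuples_def)
    have "z gs \<noteq> 0" using nz increments_path[OF x(1) gs] by (auto simp: spread_def x split: if_splits)
    have "X = map (\<lambda>a. x \<otimes> a) (path \<one> gs)" using path_translate[of x \<one> gs] x gs by simp
    then obtain a' b' where a': "a' \<in> set (path \<one> gs)" "b' \<in> set (path \<one> gs)" "a = x \<otimes> a'" "b = x \<otimes> b'"
      using ab by auto
    have "set (path \<one> gs) \<subseteq> carrier G"
      using path_in_tuples[of \<one> gs n] x by (simp add: tuples_def)
    then have "inv a \<otimes> b = inv a' \<otimes> b'"
      using a' x(1) by (simp add: subset_iff inv_mult_group m_assoc) (simp add: m_assoc[symmetric])
    then have "len (inv a \<otimes> b) \<in> ?L" using a' \<open>z gs \<noteq> 0\<close> by force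
    then show "len (inv a \<otimes> b) \<le> Max ?L" using L by (rule Max_ge[rotated])
  qed (auto simp: spread_def split: if_splits)
qed

lemma integrate_spread:
  assumes \<mu>: "invariant_functional \<mu>" and \<phi>: "bounded_fun \<phi>" and z: "z \<in> bar_chains G n"
  shows "integrate \<mu> n (spread \<phi> n z) gs = \<mu> \<phi> * z gs"
proof (cases "gs \<in> tuples (carrier G) n")
  case True
  have "\<mu> (\<lambda>x. spread \<phi> n z (path x gs)) = \<mu> (\<lambda>x. z gs * \<phi> x)"
    using True increments_path[of _ gs] path_in_tuples[of _ gs n]
    by (intro functional_cong[OF \<mu>]) (auto simp: spread_def tuples_def)
  then show ?thesis using True by (simp add: integrate_def functional_scale[OF \<mu> \<phi>])
next
  case False
  then show ?thesis using z by (simp add: integrate_def bar_chains_def)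
qed

lemma integrate_sum:
  assumes \<mu>: "invariant_functional \<mu>" and c: "\<And>j. j \<in> J \<Longrightarrow> c j \<in> uf n"
  shows "integrate \<mu> n (\<lambda>X. \<Sum>j\<in>J. a j * c j X) gs = (\<Sum>j\<in>J. a j * integrate \<mu> n (c j) gs)"
proof (cases "gs \<in> tuples (carrier G) n")
  case True
  have "\<mu> (\<lambda>x. \<Sum>j\<in>J. a j * c j (path x gs)) = (\<Sum>j\<in>J. \<mu> (\<lambda>x. a j * c j (path x gs)))"
    using c by (intro functional_sum \<mu> bounded_fun_scale bounded_fun_uf)
  also have "\<dots> = (\<Sum>j\<in>J. a j * \<mu> (\<lambda>x. c j (path x gs)))"
    using bounded_fun_uf[OF c] by (intro sum.cong refl functional_scale \<mu>)
  finally show ?thesis using True by (simp add: integrate_def)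
qed (simp add: integrate_def)

text \<open>All entries of \<open>z\<close> lie in \<open>H\<close>, so right
  \<open>H\<close>-invariance gives \<open>\<phi>\<close> the same value at the shifted base point.
  The factor \<open>\<phi> x\<close> then comes out of the boundary and leaves that of
  \<open>z\<close>.\<close>

lemma boundary_spread:
  assumes HG: "H \<subseteq> carrier G" and z: "z \<in> bar_chains G n" and zH: "\<And>X. z X \<noteq> 0 \<Longrightarrow> X \<in> tuples H n"
    and cycle: "boundary_op (bar_face G) n z = (\<lambda>x. 0)"
    and \<phi>: "bounded_fun \<phi>"
    and \<phi>H: "\<And>x h. x \<in> carrier G \<Longrightarrow> h \<in> H \<Longrightarrow> \<phi> (x \<otimes> h) = \<phi> x"
    and H: "subgroup H G"
  shows "uf_bd n (spread \<phi> n z) = (\<lambda>x. 0)"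
proof (cases n)
  case 0
  then show ?thesis by (simp add: boundary_op_def)
next
  case (Suc m)
  let ?s = "spread \<phi> n z"
  let ?S = "{gs. z gs \<noteq> 0}"
  let ?K = "\<Union>gs\<in>?S. set gs"
  have K: "finite ?K" "?K \<subseteq> carrier G"
    using z zH HG by (auto simp: bar_chains_def tuples_def)
  have "uf_bd (Suc m) ?s (path x gs) = 0" if x: "x \<in> carrier G" and gs: "gs \<in> tuples (carrier G) m" for x gs
  proof -
    have "uf_bd (Suc m) ?s (path x gs)
        = (\<Sum>j\<le>Suc m. (-1) ^ j * (\<Sum>k\<in>?K. ?s (path (base_shift j x k) (bar_insert j k gs))))"
    proof (rule uf_boundary_path[OF _ K x gs])
      fix X assume "?s X \<noteq> 0"
      then show "X \<in> tuples (carrier G) (Suc (Suc m)) \<and> set (increments X) \<subseteq> ?K"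
        by (auto simp: spread_def Suc split: if_splits)
    qed
    also have "\<dots> = (\<Sum>j\<le>Suc m. (-1) ^ j * (\<Sum>k\<in>?K. \<phi> x * z (bar_insert j k gs)))"
    proof (intro sum.cong refl arg_cong2[of _ _ _ _ "(*)"])
      fix j k assume j: "j \<in> {..Suc m}" and k: "k \<in> ?K"
      let ?g = "bar_insert j k gs"
      have kG: "k \<in> carrier G" using k K by blast
      have g: "?g \<in> tuples (carrier G) n"
        unfolding Suc using j kG gs by (intro bar_insert_in_tuples) auto
      have b: "base_shift j x k \<in> carrier G" using x kG by (simp add: base_shift_def)
      have "?s (path (base_shift j x k) ?g) = \<phi> (base_shift j x k) * z ?g"
        using path_in_tuples[OF b g] increments_path[OF b, of ?g] g by (simp add: spread_def tuples_def)
      \<comment> \<open>Where \<open>z\<close> vanishes both sides are 0; elsewhere, in the 0-th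
        face, \<open>k\<close> is an entry of a tuple in the support of \<open>z\<close>.\<close>
      moreover have "\<phi> (base_shift j x k) = \<phi> x" if "z ?g \<noteq> 0"
      proof (cases "j = 0")
        case True
        then have "k \<in> H" using zH[OF that] by (simp add: tuples_def)
        then show ?thesis
          using True \<phi>H[OF x] subgroup.m_inv_closed[OF H] by (simp add: base_shift_def)
      qed (simp add: base_shift_def)
      ultimately show "?s (path (base_shift j x k) ?g) = \<phi> x * z ?g" by (cases "z ?g = 0") auto
    qed
    also have "\<dots> = \<phi> x * (\<Sum>j\<le>Suc m. (-1) ^ j * (\<Sum>k\<in>?K. z (bar_insert j k gs)))"
      by (simp only: sum_distrib_left mult.left_commute)
    also have "(\<Sum>j\<le>Suc m. (-1) ^ j * (\<Sum>k\<in>?K. z (bar_insert j k gs))) = boundary_op (bar_face G) (Suc m) z gs"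
      using z K gs by (intro bar_boundary_eq[symmetric]) (auto simp: bar_chains_def Suc)
    also have "\<dots> = 0" using cycle by (simp add: Suc)
    finally show ?thesis by simp
  qed
  moreover have "X \<in> tuples (carrier G) (Suc m)" if "uf_bd (Suc m) ?s X \<noteq> 0" for X
    using uf_support[OF uf_boundary_in_uf that] spread_in_uf[OF \<phi> z] unfolding Suc by simp
  ultimately have "uf_bd (Suc m) ?s X = 0" for X
    by (metis tuple_is_path)
  then show ?thesis using Suc by blast
qed

text \<open>If a combination of the cycles \<open>spread (\<phi> j) n z\<close> bounds, then
  applying \<open>integrate (m i)\<close> shows that \<open>a i\<close> times \<open>z\<close>
  bounds in \<open>G\<close>, which forces \<open>a i = 0\<close>.\<close>

theorem uf_homology_infinite_dimensional:
  assumes "amenable G" and H: "subgroup H G" and inf: "infinite (rcosets H)"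
    and \<alpha>: "\<alpha> \<in> carrier (group_homology (G\<lparr>carrier := H\<rparr>) n)"
      "group_homology_map G n (\<lambda>h. h) \<alpha> \<noteq> \<zero>\<^bsub>group_homology G n\<^esub>"
  shows "\<not> vectorspace.fin_dim class_ring (uf_homology (carrier G) (\<lambda>g h. len (inv g \<otimes> h)) n)"
proof -
  let ?B = "boundary_space (bar_chains G) (boundary_op (bar_face G)) n"
  \<comment> \<open>Countability of \<open>G\<close>: it is exhausted by the finite balls of integer
    radius.\<close>
  have "carrier G \<subseteq> (\<Union>N. {g \<in> carrier G. len g \<le> real N})"
  proof
    fix g assume "g \<in> carrier G"
    moreover obtain N :: nat where "len g \<le> real N" using real_arch_simple by blast
    ultimately show "g \<in> (\<Union>N. {g \<in> carrier G. len g \<le> real N})" by blast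
  qed
  moreover have "countable (\<Union>N. {g \<in> carrier G. len g \<le> real N})"
    by (rule countable_UN) (auto intro: countable_finite finite_balls)
  ultimately have count: "countable (carrier G)" by (rule countable_subset)
  obtain z where z: "z \<in> bar_chains G n" and zH: "\<And>X. z X \<noteq> 0 \<Longrightarrow> X \<in> tuples H n"
    and cycle: "boundary_op (bar_face G) n z = (\<lambda>x. 0)" and zB: "z \<notin> ?B"
    using nontrivial_homology_mapE[OF H \<alpha>] by metis
  obtain \<mu> where \<mu>: "right_invariant_mean \<mu>"
    using amenable_imp_right_invariant_mean[OF assms(1)] .
  from dual_functionals[OF \<mu> H inf count]
  obtain m :: "nat \<Rightarrow> ('a \<Rightarrow> real) \<Rightarrow> real" and \<phi> where
    *: "(\<forall>i. invariant_functional (m i)) \<and> (\<forall>j. bounded_fun (\<phi> j)) \<and>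
      (\<forall>j. \<forall>x\<in>carrier G. \<forall>h\<in>H. \<phi> j (x \<otimes> h) = \<phi> j x) \<and>
      (\<forall>i j. m i (\<phi> j) = (if i = j then 1 else 0))"
    by (elim exE) (rule that)
  then have m: "invariant_functional (m i)" and \<phi>: "bounded_fun (\<phi> j)"
    and dual: "m i (\<phi> j) = (if i = j then 1 else 0)" for i j
    by simp_all
  have \<phi>H: "\<phi> j (x \<otimes> h) = \<phi> j x" if "x \<in> carrier G" "h \<in> H" for j x h
    using * that by simp
  let ?c = "\<lambda>j. spread (\<phi> j) n z"
  note c_uf = spread_in_uf[OF \<phi> z]
  show ?thesis
    unfolding uf_homology_def homology_def
  proof (rule quotient_not_fin_dim[OF function_subspace_uf_cycles function_subspace_uf_boundaries
        uf_boundaries_subset_cycles])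
    fix j show "?c j \<in> cycle_space uf uf_bd n"
      using c_uf boundary_spread[OF subgroup.subset[OF H] z zH cycle \<phi> \<phi>H H]
      by (simp add: cycle_space_def)
  next
    fix J a i assume J: "finite J" "i \<in> J" and "(\<lambda>X. \<Sum>j\<in>J. a j * ?c j X) \<in> boundary_space uf uf_bd n"
    then obtain e where e: "e \<in> uf (Suc n)" "(\<lambda>X. \<Sum>j\<in>J. a j * ?c j X) = uf_bd (Suc n) e"
      by (auto simp: boundary_space_def)
    let ?e = "integrate (m i) (Suc n) e"
    have "boundary_op (bar_face G) (Suc n) ?e gs = a i * z gs" for gs
    proof -
      have "boundary_op (bar_face G) (Suc n) ?e gs = (\<Sum>j\<in>J. a j * (m i (\<phi> j) * z gs))"
        unfolding integrate_boundary[OF m e(1), symmetric] e(2)[symmetric]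
        by (simp add: integrate_sum[OF m c_uf] integrate_spread[OF m \<phi> z])
      also have "\<dots> = (\<Sum>j\<in>J. if i = j then a j * z gs else 0)"
        by (intro sum.cong refl) (simp add: dual)
      also have "\<dots> = a i * z gs" using J by simp
      finally show ?thesis .
    qed
    then have "(\<lambda>gs. a i * z gs) \<in> ?B"
      using integrate_in_bar_chains[OF m e(1)] unfolding boundary_space_def by (metis (no_types) ext imageI)
    \<comment> \<open>For nonzero \<open>a i\<close> this function is \<open>z\<close> itself; for
      \<open>a i = 0\<close> it is the zero function.\<close>
    then have "(\<lambda>gs. inverse (a i) * (a i * z gs)) \<in> ?B"
      by (rule function_subspace_scale[OF function_subspace_bar_boundaries])
    then show "a i = 0" using zB by (cases "a i = 0") (auto simp: field_simps)
  qed
qed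

end

section \<open>Word metrics\<close>

context group
begin

text \<open>Written in the same \<open>LEAST\<close> form as \<open>word_metric\<close>, so that the
  two are related by unfolding.\<close>

definition word_length :: "'a set \<Rightarrow> 'a \<Rightarrow> real" where
  "word_length S g = real (LEAST k. \<exists>ss. length ss = k \<and> set ss \<subseteq> S \<union> m_inv G ` S \<and>
                        foldr (\<otimes>) ss \<one> = g)"

lemma foldr_mult_append:
  assumes "set xs \<subseteq> carrier G" "set ys \<subseteq> carrier G"
  shows "foldr (\<otimes>) (xs @ ys) \<one> = foldr (\<otimes>) xs \<one> \<otimes> foldr (\<otimes>) ys \<one>"
proof -
  have cl: "foldr (\<otimes>) zs \<one> \<in> carrier G" if "set zs \<subseteq> carrier G" for zs
    using that by (induction zs) auto
  show ?thesis using assms(1) by (induction xs) (auto simp: cl assms(2) m_assoc)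
qed

lemma generate_word:
  assumes "S \<subseteq> carrier G" "g \<in> generate G S"
  shows "\<exists>ss. set ss \<subseteq> S \<union> m_inv G ` S \<and> foldr (\<otimes>) ss \<one> = g"
  using assms(2)
proof induction
  case one
  show ?case by (intro exI[of _ "[]"]) simp
next
  case (incl h)
  then show ?case using assms(1) by (intro exI[of _ "[h]"]) auto
next
  case (inv h)
  then show ?case using assms(1) by (intro exI[of _ "[inv h]"]) auto
next
  case (eng g h)
  then obtain xs ys where "set xs \<subseteq> S \<union> m_inv G ` S" "foldr (\<otimes>) xs \<one> = g"
    "set ys \<subseteq> S \<union> m_inv G ` S" "foldr (\<otimes>) ys \<one> = h" by blast
  moreover have "S \<union> m_inv G ` S \<subseteq> carrier G" using assms(1) by auto
  ultimately show ?case
    by (intro exI[of _ "xs @ ys"]) (subst foldr_mult_append; auto)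
qed

text \<open>A ball is contained in the set of values of words of bounded length over a finite
  alphabet.\<close>

lemma proper_word_length:
  assumes "finite S" "S \<subseteq> carrier G" "generate G S = carrier G"
  shows "proper_length_group G (word_length S)"
proof unfold_locales
  fix R :: real
  let ?A = "S \<union> m_inv G ` S"
  let ?W = "{ss. set ss \<subseteq> ?A \<and> length ss \<le> nat \<lfloor>R\<rfloor>}"
  have sub: "{g \<in> carrier G. word_length S g \<le> R} \<subseteq> (\<lambda>ss. foldr (\<otimes>) ss \<one>) ` ?W"
  proof
    fix g assume "g \<in> {g \<in> carrier G. word_length S g \<le> R}"
    then have g: "g \<in> carrier G" "word_length S g \<le> R" by auto
    let ?P = "\<lambda>k. \<exists>ss. length ss = k \<and> set ss \<subseteq> ?A \<and> foldr (\<otimes>) ss \<one> = g"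
    \<comment> \<open>Since \<open>S\<close> generates, the \<open>LEAST\<close> in the word length
      is attained by an actual word.\<close>
    have "\<exists>k. ?P k" using generate_word[of S g] assms g by auto
    then have "?P (LEAST k. ?P k)" by (rule LeastI_ex)
    then obtain ss where ss: "real (length ss) = word_length S g" "set ss \<subseteq> ?A"
      "foldr (\<otimes>) ss \<one> = g" unfolding word_length_def by metis
    then have "length ss \<le> nat \<lfloor>R\<rfloor>" using g(2) by (simp add: le_nat_floor)
    with ss(2) have "ss \<in> ?W" by simp
    then show "g \<in> (\<lambda>ss. foldr (\<otimes>) ss \<one>) ` ?W" by (intro image_eqI[where x = ss]) (simp_all add: ss(3))
  qed
  have "finite ?W" using assms(1) by (intro finite_lists_length_le) simp
  from finite_subset[OF sub finite_imageI[OF this]]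
  show "finite {g \<in> carrier G. word_length S g \<le> R}" .
qed

end

theorem theorem3p8:
  fixes G :: "('a, 'b) monoid_scheme" and S H :: "'a set" and n :: nat
  assumes "group G"
    and "finite S" and "S \<subseteq> carrier G" and "generate G S = carrier G"
    and "amenable G"
    and "subgroup H G"
    and "infinite (rcosets\<^bsub>G\<^esub> H)"
    and "\<exists>\<alpha>\<in>carrier (group_homology (G\<lparr>carrier := H\<rparr>) n).
           group_homology_map G n (\<lambda>h. h) \<alpha> \<noteq> \<zero>\<^bsub>group_homology G n\<^esub>"
  shows "\<not> vectorspace.fin_dim (class_ring :: real ring) (uf_homology (carrier G) (word_metric G S) n)"
proof -
  interpret group G by fact
  \<comment> \<open>Finite generation enters here, through finiteness of the balls of the word
    metric.\<close>
  interpret proper_length_group G "word_length S" by (rule proper_word_length) fact+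
  have "word_metric G S = (\<lambda>g h. word_length S (inv\<^bsub>G\<^esub> g \<otimes>\<^bsub>G\<^esub> h))"
    by (simp add: word_metric_def word_length_def fun_eq_iff)
  then show ?thesis using assms(5-8) uf_homology_infinite_dimensional by auto
qed

end
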